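(* Let $(M,g,\eta,\nabla)$ be a semi-Weyl manifold admitting torsion (SWMT) and let $(M',g')$ be a lightlike hypersurface of $(M,g)$ with a screen distribution $S(TM')$ that is integrable. Let $\eta'$ be the induced $1$-form and let $\bar\nabla$ be the induced connection on sections of the screen distribution. Then $(g',\eta',\bar\nabla)$ is a semi-Weyl structure with torsion on $S(TM')$, i.e., for all $X,Y,Z\in\Gamma^\infty(S(TM'))$, $$(\bar\nabla_Xg')(Y,Z)+\eta'(X)g'(Y,Z)=(\bar\nabla_Yg')(X,Z)+\eta'(Y)g'(X,Z)-g'(T^{\bar\nabla}(X,Y),Z),$$ where $T^{\bar\nabla}(X,Y)=\bar\nabla_XY-\bar\nabla_YX-[X,Y]$.
   Context: For an affine connection $\nabla$ (possibly with torsion) on a pseudo-Riemannian manifold $(M,g)$ and a $1$-form $\eta$, put $T^\nabla(X,Y)=\nabla_XY-\nabla_YX-[X,Y]$. $(M,g,\eta,\nabla)$ is a SWMT if $(\nabla_Xg)(Y,Z)+\eta(X)g(Y,Z)=(\nabla_Yg)(X,Z)+\eta(Y)g(X,Z)-g(T^\nabla(X,Y),Z)$ for all vector fields $X,Y,Z$. Here $\dim M=n+2$ and the index of negativity of $g$ is greater than $0$ and less than $n+2$. A smooth hypersurface $M'$ of $M$ is lightlike if the induced tensor $g'=g|_{TM'\times TM'}$ is degenerate; the radical distribution $Rad(TM')=\{\zeta: g'(\zeta,X)=0\ \text{for all } X \text{ tangent to } M'\}$ then has rank $1$. A screen distribution $S(TM')$ is a complementary vector subbundle of $Rad(TM')$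 in $TM'$; it is non-degenerate for $g$, so $TM|_{M'}=S(TM')\oplus_\perp (S(TM'))^\perp$. Integrable means $[X,Y]\in\Gamma^\infty(S(TM'))$ for $X,Y\in\Gamma^\infty(S(TM'))$. For $X,Y\in\Gamma^\infty(S(TM'))$, $\bar\nabla_XY$ is the $S(TM')$-component of $\nabla_XY$ in this orthogonal decomposition: $\nabla_XY=\bar\nabla_XY+h(X,Y)$ with $\bar\nabla_XY\in\Gamma^\infty(S(TM'))$, $h(X,Y)\in\Gamma^\infty((S(TM'))^\perp)$. On $S(TM')$, $g'$ and $\eta'$ denote the restrictions of $g$ and $\eta$, and $(\bar\nabla_Xg')(Y,Z)=X(g'(Y,Z))-g'(\bar\nabla_XY,Z)-g'(Y,\bar\nabla_XZ)$. *)

theory Defs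
  imports "HOL-Analysis.Analysis"
begin

section \<open>Smooth functions on open subsets of a Euclidean space\<close>

(* C^k through iterated directional derivatives; only used for open U. *)
primrec Ck_on :: "nat \<Rightarrow> 'e::euclidean_space set \<Rightarrow> ('e \<Rightarrow> 'f::real_normed_vector) \<Rightarrow> bool" where
  "Ck_on 0 U f \<longleftrightarrow> continuous_on U f"
| "Ck_on (Suc k) U f \<longleftrightarrow>
     (\<forall>x\<in>U. f differentiable (at x)) \<and> (\<forall>v. Ck_on k U (\<lambda>x. frechet_derivative f (at x) v))"

definition smooth_on :: "'e::euclidean_space set \<Rightarrow> ('e \<Rightarrow> 'f::real_normed_vector) \<Rightarrow> bool" where
  "smooth_on U f \<longleftrightarrow> (\<forall>k. Ck_on k U f)"


section \<open>Smooth manifolds\<close>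

text \<open>A manifold is a whole type carrying a Hausdorff second countable topology, together with a
  smooth (not necessarily maximal) atlas modelled on a Euclidean space. A chart is a pair of its
  domain and its coordinate map; the values of the coordinate map off the domain are irrelevant.\<close>

type_synonym ('a, 'e) chart = "'a set \<times> ('a \<Rightarrow> 'e)"

definition chart_inv :: "('a, 'e) chart \<Rightarrow> 'e \<Rightarrow> 'a" where
  "chart_inv c = inv_into (fst c) (snd c)"

definition is_chart :: "('a::topological_space, 'e::euclidean_space) chart \<Rightarrow> bool" where
  "is_chart c \<longleftrightarrow> open (fst c) \<and> open (snd c ` fst c) \<and>
     homeomorphism (fst c) (snd c ` fst c) (snd c) (chart_inv c)"

definition smooth_atlas ::
  "('a::{t2_space,second_countable_topology}, 'e::euclidean_space) chart set \<Rightarrow> bool" where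
  "smooth_atlas A \<longleftrightarrow> (\<forall>c\<in>A. is_chart c) \<and> (\<Union>c\<in>A. fst c) = UNIV \<and>
     (\<forall>c\<in>A. \<forall>d\<in>A. smooth_on (snd c ` (fst c \<inter> fst d)) (snd d \<circ> chart_inv c))"

definition chart_at :: "('a, 'e) chart set \<Rightarrow> 'a \<Rightarrow> ('a, 'e) chart" where
  "chart_at A p = (SOME c. c \<in> A \<and> p \<in> fst c)"

definition smooth_fun ::
  "('a, 'e::euclidean_space) chart set \<Rightarrow> ('a \<Rightarrow> real) \<Rightarrow> bool" where
  "smooth_fun A f \<longleftrightarrow> (\<forall>c\<in>A. smooth_on (snd c ` fst c) (f \<circ> chart_inv c))"

definition smooth_map ::
  "('b::topological_space, 'h::euclidean_space) chart set \<Rightarrow>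
   ('a::topological_space, 'e::euclidean_space) chart set \<Rightarrow> ('b \<Rightarrow> 'a) \<Rightarrow> bool" where
  "smooth_map A' A i \<longleftrightarrow> continuous_on UNIV i \<and>
     (\<forall>c\<in>A'. \<forall>d\<in>A. smooth_on (snd c ` (fst c \<inter> i -` fst d)) (snd d \<circ> i \<circ> chart_inv c))"


section \<open>Tangent vectors, vector fields and tensor fields\<close>

text \<open>The tangent space at a point p is identified with the model space by means of the chart
  \<open>chart_at A p\<close>: a tangent vector at p is given by its components with respect to that chart.
  Since \<open>chart_at A p\<close> jumps as p varies, smoothness of a field is never a statement about the
  function from points to components itself; the components have to be transformed to a fixed chart
  first. This is what \<open>to_chart\<close> and its inverse \<open>of_chart\<close> are for.\<close>

definition to_chart :: "('a, 'e::euclidean_space) chart set \<Rightarrow> ('a, 'e) chart \<Rightarrow> 'a \<Rightarrow> 'e \<Rightarrow> 'e" where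
  "to_chart A c p v = frechet_derivative (snd c \<circ> chart_inv (chart_at A p)) (at (snd (chart_at A p) p)) v"

definition of_chart :: "('a, 'e::euclidean_space) chart set \<Rightarrow> ('a, 'e) chart \<Rightarrow> 'a \<Rightarrow> 'e \<Rightarrow> 'e" where
  "of_chart A c p u = frechet_derivative (snd (chart_at A p) \<circ> chart_inv c) (at (snd c p)) u"

definition vf_rep ::
  "('a, 'e::euclidean_space) chart set \<Rightarrow> ('a, 'e) chart \<Rightarrow> ('a \<Rightarrow> 'e) \<Rightarrow> 'e \<Rightarrow> 'e" where
  "vf_rep A c X x = to_chart A c (chart_inv c x) (X (chart_inv c x))"

definition smooth_vf_on ::
  "('a, 'e::euclidean_space) chart set \<Rightarrow> 'a set \<Rightarrow> ('a \<Rightarrow> 'e) \<Rightarrow> bool" where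
  "smooth_vf_on A U X \<longleftrightarrow> (\<forall>c\<in>A. smooth_on (snd c ` (fst c \<inter> U)) (vf_rep A c X))"

definition vector_fields :: "('a, 'e::euclidean_space) chart set \<Rightarrow> ('a \<Rightarrow> 'e) set" where
  "vector_fields A = {X. smooth_vf_on A UNIV X}"

(* v f for a tangent vector v at p *)
definition dir_deriv ::
  "('a, 'e::euclidean_space) chart set \<Rightarrow> 'a \<Rightarrow> 'e \<Rightarrow> ('a \<Rightarrow> real) \<Rightarrow> real" where
  "dir_deriv A p v f = frechet_derivative (f \<circ> chart_inv (chart_at A p)) (at (snd (chart_at A p) p)) v"

(* [X,Y]^k = X^j d_j Y^k - Y^j d_j X^k, evaluated at p in the chart that is used to identify the
   tangent space at p with the model space. *)
definition lie_bracket ::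
  "('a, 'e::euclidean_space) chart set \<Rightarrow> ('a \<Rightarrow> 'e) \<Rightarrow> ('a \<Rightarrow> 'e) \<Rightarrow> 'a \<Rightarrow> 'e" where
  "lie_bracket A X Y p =
     (let c = chart_at A p; x = snd c p in
        frechet_derivative (vf_rep A c Y) (at x) (vf_rep A c X x)
        - frechet_derivative (vf_rep A c X) (at x) (vf_rep A c Y x))"

definition map_diff ::
  "('b, 'h::euclidean_space) chart set \<Rightarrow> ('a, 'e::euclidean_space) chart set \<Rightarrow>
   ('b \<Rightarrow> 'a) \<Rightarrow> 'b \<Rightarrow> 'h \<Rightarrow> 'e" where
  "map_diff A' A i q u =
     frechet_derivative (snd (chart_at A (i q)) \<circ> i \<circ> chart_inv (chart_at A' q))
       (at (snd (chart_at A' q) q)) u"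

definition one_form ::
  "('a, 'e::euclidean_space) chart set \<Rightarrow> ('a \<Rightarrow> 'e \<Rightarrow> real) \<Rightarrow> bool" where
  "one_form A \<eta> \<longleftrightarrow> (\<forall>p. linear (\<eta> p)) \<and>
     (\<forall>c\<in>A. \<forall>u. smooth_on (snd c ` fst c)
        (\<lambda>x. let p = chart_inv c x in \<eta> p (of_chart A c p u)))"

definition bilinear_field ::
  "('a, 'e::euclidean_space) chart set \<Rightarrow> ('a \<Rightarrow> 'e \<Rightarrow> 'e \<Rightarrow> real) \<Rightarrow> bool" where
  "bilinear_field A g \<longleftrightarrow> (\<forall>p. bilinear (g p)) \<and>
     (\<forall>c\<in>A. \<forall>u v. smooth_on (snd c ` fst c)
        (\<lambda>x. let p = chart_inv c x in g p (of_chart A c p u) (of_chart A c p v)))"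


section \<open>Pseudo-Riemannian metrics, connections and semi-Weyl structures with torsion\<close>

definition radical :: "('e::real_vector \<Rightarrow> 'e \<Rightarrow> real) \<Rightarrow> 'e set" where
  "radical b = {z. \<forall>x. b z x = 0}"

definition neg_index :: "('e::euclidean_space \<Rightarrow> 'e \<Rightarrow> real) \<Rightarrow> nat" where
  "neg_index b = Max {dim V | V. subspace V \<and> (\<forall>v\<in>V. v \<noteq> 0 \<longrightarrow> b v v < 0)}"

definition pseudo_riemannian ::
  "('a, 'e::euclidean_space) chart set \<Rightarrow> nat \<Rightarrow> ('a \<Rightarrow> 'e \<Rightarrow> 'e \<Rightarrow> real) \<Rightarrow> bool" where
  "pseudo_riemannian A \<nu> g \<longleftrightarrow> bilinear_field A g \<and> (\<forall>p u v. g p u v = g p v u) \<and>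
     (\<forall>p. radical (g p) = {0}) \<and> (\<forall>p. neg_index (g p) = \<nu>)"

definition affine_connection ::
  "('a, 'e::euclidean_space) chart set \<Rightarrow> (('a \<Rightarrow> 'e) \<Rightarrow> ('a \<Rightarrow> 'e) \<Rightarrow> ('a \<Rightarrow> 'e)) \<Rightarrow> bool" where
  "affine_connection A D \<longleftrightarrow>
     (\<forall>X\<in>vector_fields A. \<forall>Y\<in>vector_fields A. D X Y \<in> vector_fields A) \<and>
     (\<forall>X\<in>vector_fields A. \<forall>X'\<in>vector_fields A. \<forall>Y\<in>vector_fields A. \<forall>p.
        D (\<lambda>r. X r + X' r) Y p = D X Y p + D X' Y p) \<and>
     (\<forall>f X Y p. smooth_fun A f \<longrightarrow> X \<in> vector_fields A \<longrightarrow> Y \<in> vector_fields A \<longrightarrow>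
        D (\<lambda>r. f r *\<^sub>R X r) Y p = f p *\<^sub>R D X Y p) \<and>
     (\<forall>X\<in>vector_fields A. \<forall>Y\<in>vector_fields A. \<forall>Y'\<in>vector_fields A. \<forall>p.
        D X (\<lambda>r. Y r + Y' r) p = D X Y p + D X Y' p) \<and>
     (\<forall>f X Y p. smooth_fun A f \<longrightarrow> X \<in> vector_fields A \<longrightarrow> Y \<in> vector_fields A \<longrightarrow>
        D X (\<lambda>r. f r *\<^sub>R Y r) p = dir_deriv A p (X p) f *\<^sub>R Y p + f p *\<^sub>R D X Y p)"

definition torsion ::
  "('a, 'e::euclidean_space) chart set \<Rightarrow> (('a \<Rightarrow> 'e) \<Rightarrow> ('a \<Rightarrow> 'e) \<Rightarrow> ('a \<Rightarrow> 'e)) \<Rightarrow>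
   ('a \<Rightarrow> 'e) \<Rightarrow> ('a \<Rightarrow> 'e) \<Rightarrow> 'a \<Rightarrow> 'e" where
  "torsion A D X Y p = D X Y p - D Y X p - lie_bracket A X Y p"

(* (D_X g)(Y,Z) *)
definition deriv_metric ::
  "('a, 'e::euclidean_space) chart set \<Rightarrow> (('a \<Rightarrow> 'e) \<Rightarrow> ('a \<Rightarrow> 'e) \<Rightarrow> ('a \<Rightarrow> 'e)) \<Rightarrow>
   ('a \<Rightarrow> 'e \<Rightarrow> 'e \<Rightarrow> real) \<Rightarrow> ('a \<Rightarrow> 'e) \<Rightarrow> ('a \<Rightarrow> 'e) \<Rightarrow> ('a \<Rightarrow> 'e) \<Rightarrow> 'a \<Rightarrow> real" where
  "deriv_metric A D g X Y Z p =
     dir_deriv A p (X p) (\<lambda>r. g r (Y r) (Z r)) - g p (D X Y p) (Z p) - g p (Y p) (D X Z p)"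

text \<open>The defining identity, for all vector fields X, Y, Z from a set \<open>\<Gamma>\<close>: all vector fields in the
  case of a manifold, the sections of a distribution in the case of an induced structure.\<close>

definition semi_weyl_torsion ::
  "('a, 'e::euclidean_space) chart set \<Rightarrow> ('a \<Rightarrow> 'e) set \<Rightarrow> ('a \<Rightarrow> 'e \<Rightarrow> 'e \<Rightarrow> real) \<Rightarrow>
   ('a \<Rightarrow> 'e \<Rightarrow> real) \<Rightarrow> (('a \<Rightarrow> 'e) \<Rightarrow> ('a \<Rightarrow> 'e) \<Rightarrow> ('a \<Rightarrow> 'e)) \<Rightarrow> bool" where
  "semi_weyl_torsion A \<Gamma> g \<eta> D \<longleftrightarrow>
     (\<forall>X\<in>\<Gamma>. \<forall>Y\<in>\<Gamma>. \<forall>Z\<in>\<Gamma>. \<forall>p.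
        deriv_metric A D g X Y Z p + \<eta> p (X p) * g p (Y p) (Z p) =
        deriv_metric A D g Y X Z p + \<eta> p (Y p) * g p (X p) (Z p) - g p (torsion A D X Y p) (Z p))"

definition SWMT ::
  "('a::{t2_space,second_countable_topology}, 'e::euclidean_space) chart set \<Rightarrow> nat \<Rightarrow>
   ('a \<Rightarrow> 'e \<Rightarrow> 'e \<Rightarrow> real) \<Rightarrow> ('a \<Rightarrow> 'e \<Rightarrow> real) \<Rightarrow>
   (('a \<Rightarrow> 'e) \<Rightarrow> ('a \<Rightarrow> 'e) \<Rightarrow> ('a \<Rightarrow> 'e)) \<Rightarrow> bool" where
  "SWMT A \<nu> g \<eta> D \<longleftrightarrow> smooth_atlas A \<and> pseudo_riemannian A \<nu> g \<and> one_form A \<eta> \<and>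
     affine_connection A D \<and> semi_weyl_torsion A (vector_fields A) g \<eta> D"


section \<open>Lightlike hypersurfaces and screen distributions\<close>

text \<open>A hypersurface is an injectively immersed manifold of codimension one: a manifold in its own
  right, whose points q and tangent vectors u are identified with the points \<open>i q\<close> and the tangent
  vectors \<open>map_diff A' A i q u\<close> of the ambient manifold by the inclusion i.\<close>

definition hypersurface ::
  "('b::{t2_space,second_countable_topology}, 'h::euclidean_space) chart set \<Rightarrow>
   ('a::{t2_space,second_countable_topology}, 'e::euclidean_space) chart set \<Rightarrow> ('b \<Rightarrow> 'a) \<Rightarrow> bool" where
  "hypersurface A' A i \<longleftrightarrow> smooth_atlas A' \<and> DIM('e) = DIM('h) + 1 \<and>
     smooth_map A' A i \<and> inj i \<and> (\<forall>q. inj (map_diff A' A i q))"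

definition induced_metric ::
  "('b, 'h::euclidean_space) chart set \<Rightarrow> ('a, 'e::euclidean_space) chart set \<Rightarrow> ('b \<Rightarrow> 'a) \<Rightarrow>
   ('a \<Rightarrow> 'e \<Rightarrow> 'e \<Rightarrow> real) \<Rightarrow> 'b \<Rightarrow> 'h \<Rightarrow> 'h \<Rightarrow> real" where
  "induced_metric A' A i g q u v = g (i q) (map_diff A' A i q u) (map_diff A' A i q v)"

definition induced_form ::
  "('b, 'h::euclidean_space) chart set \<Rightarrow> ('a, 'e::euclidean_space) chart set \<Rightarrow> ('b \<Rightarrow> 'a) \<Rightarrow>
   ('a \<Rightarrow> 'e \<Rightarrow> real) \<Rightarrow> 'b \<Rightarrow> 'h \<Rightarrow> real" where
  "induced_form A' A i \<eta> q u = \<eta> (i q) (map_diff A' A i q u)"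

definition lightlike_hypersurface ::
  "('b::{t2_space,second_countable_topology}, 'h::euclidean_space) chart set \<Rightarrow>
   ('a::{t2_space,second_countable_topology}, 'e::euclidean_space) chart set \<Rightarrow> ('b \<Rightarrow> 'a) \<Rightarrow>
   ('a \<Rightarrow> 'e \<Rightarrow> 'e \<Rightarrow> real) \<Rightarrow> bool" where
  "lightlike_hypersurface A' A i g \<longleftrightarrow> hypersurface A' A i \<and>
     (\<forall>q. radical (induced_metric A' A i g q) \<noteq> {0})"

definition smooth_distribution ::
  "('b::topological_space, 'h::euclidean_space) chart set \<Rightarrow> ('b \<Rightarrow> 'h set) \<Rightarrow> bool" where
  "smooth_distribution A S \<longleftrightarrow> (\<exists>k. \<forall>q. \<exists>U E. open U \<and> q \<in> U \<and> (\<forall>j<k. smooth_vf_on A U (E j)) \<and>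
     (\<forall>r\<in>U. inj_on (\<lambda>j::nat. E j r) {..<k} \<and> independent ((\<lambda>j. E j r) ` {..<k}) \<and>
        span ((\<lambda>j. E j r) ` {..<k}) = S r))"

definition screen_distribution ::
  "('b::topological_space, 'h::euclidean_space) chart set \<Rightarrow> ('b \<Rightarrow> 'h \<Rightarrow> 'h \<Rightarrow> real) \<Rightarrow>
   ('b \<Rightarrow> 'h set) \<Rightarrow> bool" where
  "screen_distribution A' g' S \<longleftrightarrow> smooth_distribution A' S \<and>
     (\<forall>q. S q \<inter> radical (g' q) = {0} \<and> {s + z | s z. s \<in> S q \<and> z \<in> radical (g' q)} = UNIV)"

definition sections ::
  "('b, 'h::euclidean_space) chart set \<Rightarrow> ('b \<Rightarrow> 'h set) \<Rightarrow> ('b \<Rightarrow> 'h) set" where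
  "sections A S = {X \<in> vector_fields A. \<forall>q. X q \<in> S q}"

definition integrable_distribution ::
  "('b, 'h::euclidean_space) chart set \<Rightarrow> ('b \<Rightarrow> 'h set) \<Rightarrow> bool" where
  "integrable_distribution A S \<longleftrightarrow>
     (\<forall>X\<in>sections A S. \<forall>Y\<in>sections A S. lie_bracket A X Y \<in> sections A S)"

text \<open>For vector fields X, Y of the hypersurface, the covariant derivative of Y along X with respect
  to the ambient connection is computed from ambient vector fields which extend X and Y near the
  point in question; the value does not depend on the extensions.\<close>

definition extends_near ::
  "('b::topological_space, 'h::euclidean_space) chart set \<Rightarrow> ('a, 'e::euclidean_space) chart set \<Rightarrow>
   ('b \<Rightarrow> 'a) \<Rightarrow> 'b \<Rightarrow> ('b \<Rightarrow> 'h) \<Rightarrow> ('a \<Rightarrow> 'e) \<Rightarrow> bool" where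
  "extends_near A' A i q X V \<longleftrightarrow> V \<in> vector_fields A \<and>
     (\<exists>U. open U \<and> q \<in> U \<and> (\<forall>r\<in>U. V (i r) = map_diff A' A i r (X r)))"

definition ambient_deriv ::
  "('b::topological_space, 'h::euclidean_space) chart set \<Rightarrow> ('a, 'e::euclidean_space) chart set \<Rightarrow>
   ('b \<Rightarrow> 'a) \<Rightarrow> (('a \<Rightarrow> 'e) \<Rightarrow> ('a \<Rightarrow> 'e) \<Rightarrow> ('a \<Rightarrow> 'e)) \<Rightarrow>
   ('b \<Rightarrow> 'h) \<Rightarrow> ('b \<Rightarrow> 'h) \<Rightarrow> 'b \<Rightarrow> 'e" where
  "ambient_deriv A' A i D X Y q =
     (THE w. \<exists>V W. extends_near A' A i q X V \<and> extends_near A' A i q Y W \<and> w = D V W (i q))"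

(* w = di(screen_part w) + h with h orthogonal to di(S) *)
definition screen_part ::
  "('b, 'h::euclidean_space) chart set \<Rightarrow> ('a, 'e::euclidean_space) chart set \<Rightarrow> ('b \<Rightarrow> 'a) \<Rightarrow>
   ('a \<Rightarrow> 'e \<Rightarrow> 'e \<Rightarrow> real) \<Rightarrow> ('b \<Rightarrow> 'h set) \<Rightarrow> 'b \<Rightarrow> 'e \<Rightarrow> 'h" where
  "screen_part A' A i g S q w =
     (THE s. s \<in> S q \<and> (\<exists>h. w = map_diff A' A i q s + h \<and>
        (\<forall>t\<in>S q. g (i q) h (map_diff A' A i q t) = 0)))"

definition screen_connection ::
  "('b::topological_space, 'h::euclidean_space) chart set \<Rightarrow> ('a, 'e::euclidean_space) chart set \<Rightarrow>
   ('b \<Rightarrow> 'a) \<Rightarrow> ('a \<Rightarrow> 'e \<Rightarrow> 'e \<Rightarrow> real) \<Rightarrow> ('b \<Rightarrow> 'h set) \<Rightarrow>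
   (('a \<Rightarrow> 'e) \<Rightarrow> ('a \<Rightarrow> 'e) \<Rightarrow> ('a \<Rightarrow> 'e)) \<Rightarrow> ('b \<Rightarrow> 'h) \<Rightarrow> ('b \<Rightarrow> 'h) \<Rightarrow> 'b \<Rightarrow> 'h" where
  "screen_connection A' A i g S D X Y q =
     screen_part A' A i g S q (ambient_deriv A' A i D X Y q)"

end

(* The connection, the metric and the Lie bracket of the ambient manifold are evaluated on ambient
   vector fields extending sections of the screen distribution. Such extensions exist since an
   immersion has smooth local left inverses, and the ambient covariant derivative along the
   hypersurface does not depend on them: in a local frame it only involves the values of the fields
   and derivatives of components in directions tangent to the hypersurface. The metric is
   non-degenerate on the screen distribution, so the orthogonal projection to it exists, and pairing
   with a section of the screen distribution does not see the part that is projected away. Since the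
   bracket of extensions extends the bracket, every term of the induced identity at a point equals the
   corresponding term of the ambient identity for the extensions. *)

theory Submission
  imports Defs
begin

section \<open>Smooth maps between Euclidean spaces\<close>

text \<open>A connection acts on globally defined fields only, so local data must be made global by
  bump functions: once to extend a field of the hypersurface, once to express \<open>D\<close> in a
  frame near a point. Moreover \<open>ambient_deriv\<close> and \<open>screen_part\<close> are
  definite descriptions, so existence and uniqueness have to be settled before either can be used.
  The inclusion is an injective immersion and need not be an embedding: other sheets of the
  hypersurface may accumulate at \<open>i q\<close>. An extension is therefore asked to agree with
  the given field only on a neighbourhood of \<open>q\<close> in the topology of the hypersurface,
  and all comparisons are local there. Tangent vectors are components in a chart chosen point by
  point, so every differentiation takes place after passing to one fixed chart. The analytic core is
  the regularity of solutions of linear systems \<open>L x (w x) = b x\<close> with injective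
  \<open>L x\<close>. It yields smoothness of local inverses and of the quotients that define bump
  functions.\<close>

lemma frechet_derivative_eqI:
  "(f has_derivative f') (at x) \<Longrightarrow> frechet_derivative f (at x) = f'"
  by (metis frechet_derivative_at)

lemma frechet_derivative_has_derivative:
  "f differentiable (at x) \<Longrightarrow> (f has_derivative frechet_derivative f (at x)) (at x)"
  by (simp add: frechet_derivative_works[symmetric])

lemma linear_sum_Basis:
  fixes L :: "'e::euclidean_space \<Rightarrow> 'f::real_vector"
  assumes "linear L" shows "L v = (\<Sum>b\<in>Basis. (v \<bullet> b) *\<^sub>R L b)"
proof -
  have "L v = L (\<Sum>b\<in>Basis. (v \<bullet> b) *\<^sub>R b)" by (simp add: euclidean_representation)
  also have "\<dots> = (\<Sum>b\<in>Basis. (v \<bullet> b) *\<^sub>R L b)" using assms by (simp add: linear_sum linear_scale)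
  finally show ?thesis .
qed

section \<open>Calculus of C^k maps: sums, products, evaluation, composition\<close>

lemma Ck_on_cong:
  assumes "open U" "\<And>x. x \<in> U \<Longrightarrow> f x = g x" "Ck_on k U f"
  shows "Ck_on k U g"
  using assms(2,3)
proof (induction k arbitrary: f g)
  case 0
  then show ?case by (simp cong: continuous_on_cong_simp)
next
  case (Suc k)
  have d: "(g has_derivative frechet_derivative f (at x)) (at x)" if "x \<in> U" for x
  proof (rule has_derivative_transform_within_open[OF _ assms(1) that])
    show "(f has_derivative frechet_derivative f (at x)) (at x)"
      using Suc.prems(2) that by (intro frechet_derivative_has_derivative) simp
  qed (use Suc.prems(1) in simp)
  have "Ck_on k U (\<lambda>x. frechet_derivative g (at x) v)" for v
  proof (rule Suc.IH[of "\<lambda>x. frechet_derivative f (at x) v"])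
    show "frechet_derivative f (at x) v = frechet_derivative g (at x) v" if "x \<in> U" for x
      using frechet_derivative_eqI[OF d[OF that]] by simp
    show "Ck_on k U (\<lambda>x. frechet_derivative f (at x) v)" using Suc.prems(2) by simp
  qed
  with d show ?case by (auto simp: differentiable_def)
qed

text \<open>\<open>frechet_derivative\<close> is a chosen representative. Any pointwise derivative
  \<open>f'\<close> may serve in its place, which is the form in which the rules of differentiation
  produce it.\<close>

lemma Ck_on_SucI:
  assumes "open U" "\<And>x. x \<in> U \<Longrightarrow> (f has_derivative f' x) (at x)"
    and "\<And>v. Ck_on k U (\<lambda>x. f' x v)"
  shows "Ck_on (Suc k) U f"
proof -
  have "Ck_on k U (\<lambda>x. frechet_derivative f (at x) v)" for v
    by (rule Ck_on_cong[OF assms(1) _ assms(3)]) (simp add: frechet_derivative_eqI[OF assms(2)])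
  with assms(2) show ?thesis by (auto simp: differentiable_def)
qed

lemma Ck_on_SucD: "Ck_on (Suc k) U f \<Longrightarrow> Ck_on k U f"
proof (induction k arbitrary: f)
  case 0
  then show ?case
    by (auto intro!: continuous_at_imp_continuous_on differentiable_imp_continuous_within)
qed auto

lemma Ck_on_subset: "Ck_on k U f \<Longrightarrow> V \<subseteq> U \<Longrightarrow> Ck_on k V f"
  by (induction k arbitrary: f) (auto intro: continuous_on_subset)

lemma Ck_on_Un: "open U \<Longrightarrow> open V \<Longrightarrow> Ck_on k U f \<Longrightarrow> Ck_on k V f \<Longrightarrow> Ck_on k (U \<union> V) f"
  by (induction k arbitrary: f) (simp_all add: continuous_on_open_Un ball_Un)

lemma Ck_on_const: "Ck_on k U (\<lambda>x. c)"
  by (induction k arbitrary: c) auto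

lemma Ck_on_bounded_linear:
  assumes "bounded_linear L" "open U"
  shows "Ck_on k U L"
proof (cases k)
  case 0
  then show ?thesis using assms by (simp add: linear_continuous_on)
next
  case (Suc j)
  show ?thesis unfolding Suc
    by (rule Ck_on_SucI[OF assms(2) bounded_linear_imp_has_derivative[OF assms(1)] Ck_on_const])
qed

lemma Ck_on_add:
  assumes "open U" "Ck_on k U f" "Ck_on k U g"
  shows "Ck_on k U (\<lambda>x. f x + g x)"
  using assms(2,3)
proof (induction k arbitrary: f g)
  case 0
  then show ?case by (simp add: continuous_on_add)
next
  case (Suc k)
  show ?case
  proof (rule Ck_on_SucI[OF assms(1)])
    show "((\<lambda>x. f x + g x) has_derivative
        (\<lambda>v. frechet_derivative f (at x) v + frechet_derivative g (at x) v)) (at x)" if "x \<in> U" for x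
      using Suc.prems that by (intro has_derivative_add frechet_derivative_has_derivative) auto
    show "Ck_on k U (\<lambda>x. frechet_derivative f (at x) v + frechet_derivative g (at x) v)" for v
      using Suc.prems by (intro Suc.IH) auto
  qed
qed

lemma Ck_on_sum:
  assumes "open U" "\<And>i. i \<in> I \<Longrightarrow> Ck_on k U (f i)"
  shows "Ck_on k U (\<lambda>x. \<Sum>i\<in>I. f i x)"
  using assms(2)
  by (induction I rule: infinite_finite_induct) (auto intro: Ck_on_const Ck_on_add assms(1))

lemma Ck_on_bilinear:
  assumes "bounded_bilinear pr" "open U" "Ck_on k U f" "Ck_on k U g"
  shows "Ck_on k U (\<lambda>x. pr (f x) (g x))"
  using assms(3,4)
proof (induction k arbitrary: f g)
  case 0
  then show ?case by (simp add: bounded_bilinear.continuous_on[OF assms(1)])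
next
  case (Suc k)
  note IH = Suc.IH and Sucp = Suc.prems
  have f: "Ck_on k U f" and g: "Ck_on k U g" using Sucp by (blast intro: Ck_on_SucD)+
  show ?case
  proof (rule Ck_on_SucI[OF assms(2)])
    show "((\<lambda>x. pr (f x) (g x)) has_derivative (\<lambda>v. pr (f x) (frechet_derivative g (at x) v)
          + pr (frechet_derivative f (at x) v) (g x))) (at x)" if "x \<in> U" for x
      using Sucp that
      by (intro bounded_bilinear.FDERIV[OF assms(1)] frechet_derivative_has_derivative) auto
    show "Ck_on k U (\<lambda>x. pr (f x) (frechet_derivative g (at x) v)
          + pr (frechet_derivative f (at x) v) (g x))" for v
      using Sucp by (intro Ck_on_add[OF assms(2)] IH f g) auto
  qed
qed

text \<open>Expansion of \<open>w x\<close> in the basis turns evaluation into a sum of products.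
  Operator fields are thereby handled through \<open>L x v\<close> with \<open>v\<close> fixed,
  which is how \<open>Ck_on\<close> sees derivatives.\<close>

lemma Ck_on_apply_linear:
  fixes w :: "'d::euclidean_space \<Rightarrow> 'e::euclidean_space"
  assumes "open U" "\<And>x. x \<in> U \<Longrightarrow> linear (L x)" "\<And>v. Ck_on k U (\<lambda>x. L x v)" "Ck_on k U w"
  shows "Ck_on k U (\<lambda>x. L x (w x))"
proof (rule Ck_on_cong[OF assms(1)])
  show "(\<Sum>b\<in>Basis. (w x \<bullet> b) *\<^sub>R L x b) = L x (w x)" if "x \<in> U" for x
    by (rule linear_sum_Basis[OF assms(2)[OF that], symmetric])
  show "Ck_on k U (\<lambda>x. \<Sum>b\<in>Basis. (w x \<bullet> b) *\<^sub>R L x b)"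
    by (intro Ck_on_sum Ck_on_bilinear[OF bounded_bilinear_scaleR]
        Ck_on_bilinear[OF bounded_bilinear_inner] Ck_on_const assms)
qed

text \<open>By the chain rule the derivative is the derivative of \<open>f\<close> at
  \<open>g x\<close>, an operator field, evaluated at the derivative of \<open>g\<close>. The
  induction hypothesis serves the directional derivatives of \<open>f\<close>, with the same
  \<open>g\<close> seen one degree lower.\<close>

lemma Ck_on_compose:
  fixes g :: "'d::euclidean_space \<Rightarrow> 'e::euclidean_space"
  assumes "open U" "g ` U \<subseteq> V" "Ck_on k V f" "Ck_on k U g"
  shows "Ck_on k U (f \<circ> g)"
  using assms(3,4)
proof (induction k arbitrary: f)
  case 0
  then show ?case using assms(2) by (simp add: continuous_on_compose2[of V f U g] comp_def)
next
  case (Suc k)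
  have g: "Ck_on k U g" using Suc.prems by (blast intro: Ck_on_SucD)
  have df: "(f has_derivative frechet_derivative f (at (g x))) (at (g x))" if "x \<in> U" for x
    using Suc.prems(1) assms(2) that by (intro frechet_derivative_has_derivative) auto
  have dg: "(g has_derivative frechet_derivative g (at x)) (at x)" if "x \<in> U" for x
    using Suc.prems(2) that by (intro frechet_derivative_has_derivative) auto
  have Cf: "Ck_on k U (\<lambda>x. frechet_derivative f (at (g x)) u)" for u
    using Suc.prems(1) by (intro Suc.IH[of "\<lambda>y. frechet_derivative f (at y) u", unfolded comp_def] g) simp
  show ?case
  proof (rule Ck_on_SucI[OF assms(1)])
    show "((f \<circ> g) has_derivative
      (\<lambda>v. frechet_derivative f (at (g x)) (frechet_derivative g (at x) v))) (at x)" if "x \<in> U" for x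
      using has_derivative_compose[OF dg[OF that] df[OF that]] by (simp add: comp_def)
    show "Ck_on k U (\<lambda>x. frechet_derivative f (at (g x)) (frechet_derivative g (at x) v))" for v
    proof (rule Ck_on_apply_linear[OF assms(1) _ Cf])
      show "linear (frechet_derivative f (at (g x)))" if "x \<in> U" for x
        using df[OF that] by (rule has_derivative_linear)
    qed (use Suc.prems(2) in simp)
  qed
qed

section \<open>Linear systems with varying coefficients\<close>

text \<open>\<open>f\<close> is of first order at \<open>x\<close> and \<open>h\<close> tends to 0,
  so the product is o(|y - x|). Only continuity of \<open>h\<close> is asked: in the linear systems
  below, \<open>h\<close> is a component of the solution, not yet known to be
  differentiable.\<close>

lemma has_derivative_scaleR_zero:
  fixes f :: "'a::real_normed_vector \<Rightarrow> 'b::real_normed_vector" and h :: "'a \<Rightarrow> real"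
  assumes f: "(f has_derivative f') (at x)" "f x = 0" and h: "isCont h x" "h x = 0"
  shows "((\<lambda>y. h y *\<^sub>R f y) has_derivative (\<lambda>_. 0)) (at x)"
  unfolding has_derivative_at_alt
proof (intro conjI allI impI)
  fix e :: real assume "0 < e"
  obtain B where B: "B > 0" "norm (f' v) \<le> norm v * B" for v
    using f(1) by (meson bounded_linear.pos_bounded has_derivative_bounded_linear)
  obtain d1 where d1: "d1 > 0" "\<And>y. norm (y - x) < d1 \<Longrightarrow> norm (f y - f x - f' (y - x)) \<le> 1 * norm (y - x)"
    using f(1) unfolding has_derivative_at_alt by (metis zero_less_one)
  \<comment> \<open>Near \<open>x\<close> the norm of \<open>f y\<close> is at most
    \<open>(B + 1) * norm (y - x)\<close>: \<open>B\<close> from the derivative, 1 from the error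
    term.\<close>
  obtain d2 where d2: "d2 > 0" "\<And>y. norm (y - x) < d2 \<Longrightarrow> \<bar>h y\<bar> < e / (B + 1)"
    using h \<open>0 < e\<close> B(1) unfolding continuous_at_eps_delta by (auto simp: dist_norm dest!: spec[of _ "e / (B + 1)"])
  have "norm (h y *\<^sub>R f y) \<le> e * norm (y - x)" if "norm (y - x) < min d1 d2" for y
  proof -
    have "norm (f y) \<le> norm (f y - f x - f' (y - x)) + norm (f' (y - x))"
      using norm_triangle_sub[of "f y" "f' (y - x)"] by (simp add: f(2))
    also have "\<dots> \<le> (B + 1) * norm (y - x)"
      using d1(2)[of y] B(2)[of "y - x"] that by (simp add: algebra_simps)
    finally have "norm (h y *\<^sub>R f y) \<le> e / (B + 1) * ((B + 1) * norm (y - x))"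
      using d2(2)[of y] that \<open>0 < e\<close> B(1) by (simp only: norm_scaleR, intro mult_mono) auto
    then show ?thesis using B(1) by simp
  qed
  then show "\<exists>d>0. \<forall>y. norm (y - x) < d \<longrightarrow>
      norm (h y *\<^sub>R f y - h x *\<^sub>R f x - 0) \<le> e * norm (y - x)"
    using d1(1) d2(1) by (intro exI[of _ "min d1 d2"]) (simp add: f(2))
qed simp

text \<open>Subtract the systems at \<open>x\<close> and \<open>y\<close> and apply a left inverse
  \<open>M\<close> of \<open>L x\<close>. The unknown \<open>w y\<close> reappears on the right only
  multiplied by the small differences \<open>L y c - L x c\<close>. Absorbing that term gives
  continuity of \<open>w\<close>, and continuity in turn makes the term negligible to first
  order.\<close>

lemma linear_solve_identity:
  fixes L :: "'d \<Rightarrow> 'e::euclidean_space \<Rightarrow> 'c::real_vector"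
  assumes "linear M" "linear (L x)" "linear (L y)" "M \<circ> L x = id" "L x (w x) = b x" "L y (w y) = b y"
  shows "w y = w x + M (b y - b x - (L y (w x) - L x (w x))
           - (\<Sum>c\<in>Basis. ((w y - w x) \<bullet> c) *\<^sub>R (L y c - L x c)))"
proof -
  have "linear (\<lambda>v. L y v - L x v)" using assms(3,2) by (rule linear_compose_sub)
  then have s: "L y v - L x v = (\<Sum>c\<in>Basis. (v \<bullet> c) *\<^sub>R (L y c - L x c))" for v
    by (rule linear_sum_Basis)
  have "b y - b x - (L y (w x) - L x (w x)) - (L y (w y - w x) - L x (w y - w x)) = L x (w y - w x)"
    using assms(2,3,5,6) by (simp add: linear_diff)
  then have "M (b y - b x - (L y (w x) - L x (w x))
      - (\<Sum>c\<in>Basis. ((w y - w x) \<bullet> c) *\<^sub>R (L y c - L x c))) = w y - w x"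
    using assms(4) by (simp add: s[symmetric] pointfree_idE)
  then show ?thesis by simp
qed

lemma continuous_linear_solve:
  fixes L :: "'d::real_normed_vector \<Rightarrow> 'e::euclidean_space \<Rightarrow> 'c::euclidean_space"
  assumes U: "open U" "x \<in> U" and L: "\<And>x. x \<in> U \<Longrightarrow> linear (L x)" "inj (L x)"
    and w: "\<And>x. x \<in> U \<Longrightarrow> L x (w x) = b x"
    and C: "\<And>v. continuous_on U (\<lambda>x. L x v)" "continuous_on U b"
  shows "isCont w x"
proof -
  obtain M where M: "linear M" "M \<circ> L x = id"
    using linear_injective_left_inverse[OF L(1)[OF U(2)] L(2)] by blast
  obtain K where K: "K > 0" "norm (M v) \<le> K * norm v" for v
    using linear_bounded_pos[OF M(1)] by blast
  define e where "e y = (\<Sum>c\<in>Basis. norm (L y c - L x c))" for y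
  define s where "s y = b y - b x - (L y (w x) - L x (w x))" for y
  have Cx: "isCont (\<lambda>y. L y v) x" "isCont b x" for v
    using C U continuous_on_eq_continuous_at by blast+
  have e: "(e \<longlongrightarrow> 0) (at x)"
    unfolding e_def using Cx(1) by (intro tendsto_null_sum tendsto_norm_zero LIM_zero) (simp add: isCont_def)
  have s: "(s \<longlongrightarrow> 0) (at x)"
  proof -
    have "(s \<longlongrightarrow> b x - b x - (L x (w x) - L x (w x))) (at x)"
      unfolding s_def using Cx by (intro tendsto_intros) (auto simp: isCont_def)
    then show ?thesis by simp
  qed
  have "\<forall>\<^sub>F y in at x. y \<in> U" using U by (simp add: eventually_at_in_open')
  \<comment> \<open>At this size the term containing \<open>w y - w x\<close> on the right is at
    most half of the left side and can be absorbed.\<close>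
  moreover have "\<forall>\<^sub>F y in at x. e y < 1 / (2 * K)"
    using e K(1) by (intro order_tendstoD(2)[OF e]) auto
  ultimately have "\<forall>\<^sub>F y in at x. norm (w y - w x) \<le> 2 * K * norm (s y)"
  proof eventually_elim
    case (elim y)
    have "norm (\<Sum>c\<in>Basis. ((w y - w x) \<bullet> c) *\<^sub>R (L y c - L x c)) \<le> norm (w y - w x) * e y"
      unfolding e_def sum_distrib_left
      by (rule order.trans[OF norm_sum]) (auto intro!: sum_mono mult_right_mono Basis_le_norm)
    moreover have "w y - w x = M (s y - (\<Sum>c\<in>Basis. ((w y - w x) \<bullet> c) *\<^sub>R (L y c - L x c)))"
      unfolding s_def diff_eq_eq
      using linear_solve_identity[of M L x y w b, OF M(1) L(1)[OF U(2)] L(1)[OF elim(1)] M(2)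
          w[OF U(2)] w[OF elim(1)]] by (simp only: add.commute)
    then have "norm (w y - w x) \<le>
        K * norm (s y - (\<Sum>c\<in>Basis. ((w y - w x) \<bullet> c) *\<^sub>R (L y c - L x c)))"
      using K(2) by metis
    moreover have "norm (s y - (\<Sum>c\<in>Basis. ((w y - w x) \<bullet> c) *\<^sub>R (L y c - L x c))) \<le>
        norm (s y) + norm (\<Sum>c\<in>Basis. ((w y - w x) \<bullet> c) *\<^sub>R (L y c - L x c))"
      by (rule norm_triangle_ineq4)
    ultimately have "norm (w y - w x) \<le> K * (norm (s y) + norm (w y - w x) * e y)"
      using K(1) by (smt (verit, best) mult_left_mono)
    also have "\<dots> \<le> K * (norm (s y) + norm (w y - w x) * (1 / (2 * K)))"
      using elim(2) K(1) by (intro mult_left_mono add_left_mono) auto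
    also have "\<dots> = K * norm (s y) + norm (w y - w x) / 2" using K(1) by (simp add: field_simps)
    finally show ?case by simp
  qed
  moreover have "((\<lambda>y. 2 * K * norm (s y)) \<longlongrightarrow> 0) (at x)"
    using s by (intro tendsto_mult_right_zero tendsto_norm_zero)
  ultimately have "((\<lambda>y. w y - w x) \<longlongrightarrow> 0) (at x)"
    by (rule Lim_null_comparison)
  then show ?thesis unfolding isCont_def by (rule LIM_zero_cancel)
qed

lemma has_derivative_linear_solve:
  fixes L :: "'d::real_normed_vector \<Rightarrow> 'e::euclidean_space \<Rightarrow> 'c::euclidean_space"
  assumes U: "open U" "x \<in> U" and L: "\<And>x. x \<in> U \<Longrightarrow> linear (L x)" "inj (L x)"
    and w: "\<And>x. x \<in> U \<Longrightarrow> L x (w x) = b x"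
    and C: "\<And>v. continuous_on U (\<lambda>x. L x v)" "continuous_on U b"
    and D: "\<And>v. ((\<lambda>x. L x v) has_derivative (\<lambda>u. L' u v)) (at x)" "(b has_derivative b') (at x)"
  obtains w' where "(w has_derivative w') (at x)" "\<And>u. L x (w' u) = b' u - L' u (w x)"
proof -
  have cont: "isCont w x" by (rule continuous_linear_solve[OF U L w C])
  obtain M where M: "linear M" "M \<circ> L x = id"
    using linear_injective_left_inverse[OF L(1)[OF U(2)] L(2)] by blast
  define w' where "w' u = M (b' u - L' u (w x))" for u
  \<comment> \<open>Each summand is a differentiable factor times a continuous one, both vanishing
    at \<open>x\<close>, so the remainder has derivative 0.\<close>
  have "((\<lambda>y. \<Sum>c\<in>Basis. ((w y - w x) \<bullet> c) *\<^sub>R (L y c - L x c)) has_derivative (\<lambda>u. \<Sum>c\<in>(Basis::'e set). 0)) (at x)"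
  proof (intro has_derivative_sum has_derivative_scaleR_zero)
    show "isCont (\<lambda>y. (w y - w x) \<bullet> c) x" for c using cont by (intro continuous_intros)
    show "((\<lambda>y. L y c - L x c) has_derivative (\<lambda>u. L' u c - 0)) (at x)" for c
      by (intro has_derivative_diff D has_derivative_const)
  qed auto
  then have "((\<lambda>y. w x + M (b y - b x - (L y (w x) - L x (w x))
           - (\<Sum>c\<in>Basis. ((w y - w x) \<bullet> c) *\<^sub>R (L y c - L x c)))) has_derivative
           (\<lambda>u. 0 + M (b' u - 0 - (L' u (w x) - 0) - (\<Sum>c\<in>(Basis::'e set). 0)))) (at x)"
    using M(1) by (intro has_derivative_add has_derivative_const has_derivative_diff D
        bounded_linear.has_derivative[of M]) (auto simp: linear_conv_bounded_linear)
  then have w': "(w has_derivative w') (at x)"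
    unfolding w'_def
    by (rule has_derivative_transform_within_open[OF _ U, THEN has_derivative_eq_rhs])
      (use linear_solve_identity[of M L x _ w b] L(1) M w U(2) in \<open>auto simp: fun_eq_iff\<close>)
  \<comment> \<open>\<open>L x\<close> need not be onto, so the equation for \<open>w'\<close>
    cannot be read off from its definition by \<open>M\<close>. It comes from differentiating
    \<open>L y (w y) = b y\<close>, now that \<open>w\<close> is known to be differentiable.\<close>
  have "((\<lambda>y. \<Sum>c\<in>Basis. (w y \<bullet> c) *\<^sub>R L y c) has_derivative
      (\<lambda>u. \<Sum>c\<in>Basis. (w x \<bullet> c) *\<^sub>R L' u c + (w' u \<bullet> c) *\<^sub>R L x c)) (at x)"
    by (intro has_derivative_sum has_derivative_scaleR has_derivative_inner_left w' D)
  then have "(b has_derivative (\<lambda>u. \<Sum>c\<in>Basis. (w x \<bullet> c) *\<^sub>R L' u c + (w' u \<bullet> c) *\<^sub>R L x c)) (at x)"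
    by (rule has_derivative_transform_within_open[OF _ U]) (simp add: w linear_sum_Basis[OF L(1), symmetric])
  then have b': "b' u = (\<Sum>c\<in>Basis. (w x \<bullet> c) *\<^sub>R L' u c + (w' u \<bullet> c) *\<^sub>R L x c)" for u
    by (rule fun_cong[OF has_derivative_unique[OF D(2)]])
  \<comment> \<open>Linearity of \<open>L' u\<close> is not assumed. The expansion of
    \<open>L' u (w x)\<close> in the basis follows from uniqueness of the derivative of
    \<open>L y (w x)\<close> in \<open>y\<close>.\<close>
  have L': "((\<lambda>y. \<Sum>c\<in>Basis. (w x \<bullet> c) *\<^sub>R L y c) has_derivative
      (\<lambda>u. \<Sum>c\<in>Basis. (w x \<bullet> c) *\<^sub>R L' u c)) (at x)"
    by (intro has_derivative_sum has_derivative_scaleR_right D)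
  have "((\<lambda>y. L y (w x)) has_derivative (\<lambda>u. \<Sum>c\<in>Basis. (w x \<bullet> c) *\<^sub>R L' u c)) (at x)"
    by (rule has_derivative_transform_within_open[OF L' U]) (simp add: linear_sum_Basis[OF L(1), symmetric])
  then have "L' u (w x) = (\<Sum>c\<in>Basis. (w x \<bullet> c) *\<^sub>R L' u c)" for u
    by (rule fun_cong[OF has_derivative_unique[OF D(1)]])
  then have "L x (w' u) = b' u - L' u (w x)" for u
    unfolding b' by (simp add: sum.distrib linear_sum_Basis[OF L(1)[OF U(2)], symmetric])
  with w' show thesis by (rule that)
qed

text \<open>The derivative of a solution \<open>w\<close> of \<open>L w = b\<close> solves \<open>L (dw) = db - (dL) w\<close>, whose right
  hand side is as regular as \<open>w\<close>; this permits an induction on k without determinants.\<close>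

lemma Ck_on_linear_solve:
  fixes b :: "'d::euclidean_space \<Rightarrow> 'c::euclidean_space" and w :: "'d \<Rightarrow> 'e::euclidean_space"
  assumes U: "open U" and L: "\<And>x. x \<in> U \<Longrightarrow> linear (L x)" "\<And>x. x \<in> U \<Longrightarrow> inj (L x)"
    and "\<And>x. x \<in> U \<Longrightarrow> L x (w x) = b x"
    and "\<And>v. Ck_on k U (\<lambda>x. L x v)" "Ck_on k U b"
  shows "Ck_on k U w"
  using assms(4-6)
proof (induction k arbitrary: w b)
  case 0
  then show ?case
    by (simp, intro continuous_at_imp_continuous_on ballI)
      (rule continuous_linear_solve[OF U _ L, where w = w and b = b]; simp)
next
  case (Suc k)
  define L' where "L' x u v = frechet_derivative (\<lambda>y. L y v) (at x) u" for x u v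
  define b' where "b' x = frechet_derivative b (at x)" for x
  have CL: "Ck_on k U (\<lambda>x. L x v)" for v using Suc.prems by (blast intro: Ck_on_SucD)
  have Cb: "Ck_on k U b" using Suc.prems by (blast intro: Ck_on_SucD)
  have w: "Ck_on k U w" by (rule Suc.IH[OF Suc.prems(1) CL Cb])
  have dL: "((\<lambda>x. L x v) has_derivative (\<lambda>u. L' x u v)) (at x)" if "x \<in> U" for x v
    unfolding L'_def using Suc.prems(2) that frechet_derivative_has_derivative by force
  have db: "(b has_derivative b' x) (at x)" if "x \<in> U" for x
    unfolding b'_def using Suc.prems(3) that frechet_derivative_has_derivative by force
  have cont: "continuous_on U (\<lambda>x. L x v)" "continuous_on U b" for v
    using dL db by (meson has_derivative_continuous continuous_at_imp_continuous_on)+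
  have "\<exists>w'. (w has_derivative w') (at x) \<and> (\<forall>u. L x (w' u) = b' x u - L' x u (w x))" if "x \<in> U" for x
    using has_derivative_linear_solve[of U x L w b "L' x" "b' x", OF U that L(1) L(2)[OF that] Suc.prems(1) cont
        dL[OF that] db[OF that]] by metis
  then obtain w' where w': "\<And>x. x \<in> U \<Longrightarrow> (w has_derivative w' x) (at x)"
      "\<And>x u. x \<in> U \<Longrightarrow> L x (w' x u) = b' x u - L' x u (w x)" by metis
  \<comment> \<open>Linearity in \<open>v\<close> is inherited from \<open>L y\<close> by uniqueness
    of derivatives.\<close>
  have linL': "linear (L' x u)" if "x \<in> U" for x u
  proof (rule linearI)
    fix v1 v2 and r :: real
    have "((\<lambda>y. L y v1 + L y v2) has_derivative (\<lambda>u. L' x u v1 + L' x u v2)) (at x)"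
      by (intro has_derivative_add dL that)
    then have "((\<lambda>y. L y (v1 + v2)) has_derivative (\<lambda>u. L' x u v1 + L' x u v2)) (at x)"
      by (rule has_derivative_transform_within_open[OF _ U that]) (simp add: linear_add[OF L(1)])
    then show "L' x u (v1 + v2) = L' x u v1 + L' x u v2"
      by (rule fun_cong[OF has_derivative_unique[OF dL[OF that]]])
    have "((\<lambda>y. r *\<^sub>R L y v1) has_derivative (\<lambda>u. r *\<^sub>R L' x u v1)) (at x)"
      by (intro has_derivative_scaleR_right dL that)
    then have "((\<lambda>y. L y (r *\<^sub>R v1)) has_derivative (\<lambda>u. r *\<^sub>R L' x u v1)) (at x)"
      by (rule has_derivative_transform_within_open[OF _ U that]) (simp add: linear_scale[OF L(1)])
    then show "L' x u (r *\<^sub>R v1) = r *\<^sub>R L' x u v1"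
      by (rule fun_cong[OF has_derivative_unique[OF dL[OF that]]])
  qed
  have CL': "Ck_on k U (\<lambda>x. L' x u v)" and Cb': "Ck_on k U (\<lambda>x. b' x u)" for u v
    using Suc.prems by (simp_all add: L'_def b'_def)
  have "Ck_on k U (\<lambda>x. L' x u (w x))" for u
    by (rule Ck_on_apply_linear[OF U linL' CL' w])
  then have "Ck_on k U (\<lambda>x. b' x u + (- 1) *\<^sub>R L' x u (w x))" for u
    by (rule Ck_on_add[OF U Cb' Ck_on_bilinear[OF bounded_bilinear_scaleR U Ck_on_const]])
  then have C: "Ck_on k U (\<lambda>x. b' x u - L' x u (w x))" for u by simp
  show ?case
  proof (rule Ck_on_SucI[OF U w'(1)])
    show "Ck_on k U (\<lambda>x. w' x v)" for v by (rule Suc.IH[OF w'(2) CL C])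
  qed
qed

section \<open>Smooth maps: the rules in all degrees at once\<close>

lemma smooth_on_cong:
  "open U \<Longrightarrow> (\<And>x. x \<in> U \<Longrightarrow> f x = g x) \<Longrightarrow> smooth_on U f \<Longrightarrow> smooth_on U g"
  unfolding smooth_on_def using Ck_on_cong[of U f g] by blast

lemma smooth_on_subset: "smooth_on U f \<Longrightarrow> V \<subseteq> U \<Longrightarrow> smooth_on V f"
  unfolding smooth_on_def using Ck_on_subset by blast

lemma smooth_on_Un: "open U \<Longrightarrow> open V \<Longrightarrow> smooth_on U f \<Longrightarrow> smooth_on V f \<Longrightarrow> smooth_on (U \<union> V) f"
  unfolding smooth_on_def using Ck_on_Un by blast

lemma smooth_on_const: "smooth_on U (\<lambda>x. c)"
  by (simp add: smooth_on_def Ck_on_const)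

lemma smooth_on_bounded_linear: "bounded_linear L \<Longrightarrow> open U \<Longrightarrow> smooth_on U L"
  by (simp add: smooth_on_def Ck_on_bounded_linear)

lemma smooth_on_add:
  "open U \<Longrightarrow> smooth_on U f \<Longrightarrow> smooth_on U g \<Longrightarrow> smooth_on U (\<lambda>x. f x + g x)"
  by (simp add: smooth_on_def Ck_on_add)

lemma smooth_on_bilinear:
  "bounded_bilinear pr \<Longrightarrow> open U \<Longrightarrow> smooth_on U f \<Longrightarrow> smooth_on U g \<Longrightarrow>
    smooth_on U (\<lambda>x. pr (f x) (g x))"
  by (simp add: smooth_on_def Ck_on_bilinear)

lemmas smooth_on_scaleR = smooth_on_bilinear[OF bounded_bilinear_scaleR]
  and smooth_on_inner = smooth_on_bilinear[OF bounded_bilinear_inner]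

lemma smooth_on_mult:
  fixes f g :: "'e::euclidean_space \<Rightarrow> real"
  shows "open U \<Longrightarrow> smooth_on U f \<Longrightarrow> smooth_on U g \<Longrightarrow> smooth_on U (\<lambda>x. f x * g x)"
  by (rule smooth_on_bilinear[OF bounded_bilinear_mult])

lemma smooth_on_diff:
  assumes "open U" "smooth_on U f" "smooth_on U g"
  shows "smooth_on U (\<lambda>x. f x - g x)"
proof -
  have "smooth_on U (\<lambda>x. f x + (- 1) *\<^sub>R g x)"
    by (rule smooth_on_add[OF assms(1,2) smooth_on_scaleR[OF assms(1) smooth_on_const assms(3)]])
  then show ?thesis by simp
qed

lemma smooth_on_apply_linear:
  fixes w :: "'d::euclidean_space \<Rightarrow> 'e::euclidean_space"
  assumes "open U" "\<And>x. x \<in> U \<Longrightarrow> linear (L x)" "\<And>v. smooth_on U (\<lambda>x. L x v)" "smooth_on U w"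
  shows "smooth_on U (\<lambda>x. L x (w x))"
  using Ck_on_apply_linear[of U L _ w] assms unfolding smooth_on_def by blast

lemma smooth_on_compose:
  fixes g :: "'d::euclidean_space \<Rightarrow> 'e::euclidean_space"
  shows "open U \<Longrightarrow> g ` U \<subseteq> V \<Longrightarrow> smooth_on V f \<Longrightarrow> smooth_on U g \<Longrightarrow> smooth_on U (f \<circ> g)"
  using Ck_on_compose[of U g V _ f] unfolding smooth_on_def by blast

lemma smooth_on_differentiable: "smooth_on U f \<Longrightarrow> x \<in> U \<Longrightarrow> f differentiable (at x)"
  unfolding smooth_on_def using Ck_on.simps(2) by blast

lemma smooth_on_frechet_derivative:
  "smooth_on U f \<Longrightarrow> smooth_on U (\<lambda>x. frechet_derivative f (at x) v)"
  unfolding smooth_on_def using Ck_on.simps(2) by blast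

lemma smooth_on_has_derivative:
  "smooth_on U f \<Longrightarrow> x \<in> U \<Longrightarrow> (f has_derivative frechet_derivative f (at x)) (at x)"
  by (rule frechet_derivative_has_derivative[OF smooth_on_differentiable])

lemma smooth_on_isCont: "smooth_on U f \<Longrightarrow> x \<in> U \<Longrightarrow> isCont f x"
  by (rule has_derivative_continuous[OF smooth_on_has_derivative])

lemma smooth_on_continuous_on: "smooth_on U f \<Longrightarrow> continuous_on U f"
  unfolding smooth_on_def using Ck_on.simps(1) by blast

lemma smooth_on_linear_solve:
  fixes b :: "'d::euclidean_space \<Rightarrow> 'c::euclidean_space" and w :: "'d \<Rightarrow> 'e::euclidean_space"
  assumes "open U" "\<And>x. x \<in> U \<Longrightarrow> linear (L x)" "\<And>x. x \<in> U \<Longrightarrow> inj (L x)"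
    and "\<And>x. x \<in> U \<Longrightarrow> L x (w x) = b x"
    and "\<And>v. smooth_on U (\<lambda>x. L x v)" "smooth_on U b"
  shows "smooth_on U w"
  using Ck_on_linear_solve[of U L w b] assms unfolding smooth_on_def by blast

section \<open>Symmetry of second derivatives\<close>

lemma mean_value_direction:
  fixes h :: "'e::euclidean_space \<Rightarrow> real"
  assumes "0 < t" "\<And>s. 0 \<le> s \<Longrightarrow> s \<le> t \<Longrightarrow> h differentiable (at (x + s *\<^sub>R u))"
  obtains s where "0 < s" "s < t" "h (x + t *\<^sub>R u) - h x = t * frechet_derivative h (at (x + s *\<^sub>R u)) u"
proof -
  have "((\<lambda>s. h (x + s *\<^sub>R u)) has_real_derivative frechet_derivative h (at (x + s *\<^sub>R u)) u) (at s)"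
    if "0 \<le> s" "s \<le> t" for s
  proof -
    have d: "(h has_derivative frechet_derivative h (at (x + s *\<^sub>R u))) (at (x + s *\<^sub>R u))"
      by (rule frechet_derivative_has_derivative[OF assms(2)[OF that]])
    have "((\<lambda>s. x + s *\<^sub>R u) has_derivative (\<lambda>r. r *\<^sub>R u)) (at s)"
      by (auto intro!: derivative_eq_intros)
    from has_derivative_compose[OF this d]
    show ?thesis
      by (simp add: has_field_derivative_def linear_scale[OF has_derivative_linear[OF d]] mult_commute_abs)
  qed
  from MVT2[OF assms(1) this] obtain s where "0 < s" "s < t"
    "h (x + t *\<^sub>R u) - h (x + 0 *\<^sub>R u) = (t - 0) * frechet_derivative h (at (x + s *\<^sub>R u)) u"
    by blast
  then show thesis by (intro that[of s]) simp_all
qed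

text \<open>Two mean value steps: in direction \<open>u\<close> for the increment
  \<open>h y = f (y + t v) - f y\<close>, then in direction \<open>v\<close> for the derivative of
  \<open>f\<close> along \<open>u\<close>. The bound on \<open>t\<close> keeps the whole
  parallelogram inside the ball.\<close>

lemma second_difference:
  fixes f :: "'e::euclidean_space \<Rightarrow> real"
  assumes "open U" and f: "smooth_on U f" and r: "ball x r \<subseteq> U" and t: "0 < t" "t * (norm u + norm v) < r"
  obtains y where "y \<in> ball x r" and "f (x + t *\<^sub>R u + t *\<^sub>R v) - f (x + t *\<^sub>R u) - f (x + t *\<^sub>R v) + f x
    = t * t * frechet_derivative (\<lambda>y. frechet_derivative f (at y) u) (at y) v"
proof -
  have ball: "x + s *\<^sub>R u + s' *\<^sub>R v \<in> ball x r" if "0 \<le> s" "s \<le> t" "0 \<le> s'" "s' \<le> t" for s s'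
  proof -
    have "norm (s *\<^sub>R u + s' *\<^sub>R v) \<le> s * norm u + s' * norm v"
      using norm_triangle_ineq[of "s *\<^sub>R u" "s' *\<^sub>R v"] that by simp
    also have "\<dots> \<le> t * norm u + t * norm v"
      using that by (intro add_mono mult_right_mono) auto
    also have "\<dots> < r" using t by (simp add: algebra_simps)
    finally have "dist (x + 0) (x + (s *\<^sub>R u + s' *\<^sub>R v)) < r"
      by (simp only: dist_add_cancel dist_0_norm)
    then show ?thesis by (simp add: add.assoc)
  qed
  note inU = subsetD[OF r ball]
  define h where "h y = f (y + t *\<^sub>R v) - f y" for y
  have df: "(f has_derivative frechet_derivative f (at (x + s *\<^sub>R u + s' *\<^sub>R v))) (at (x + s *\<^sub>R u + s' *\<^sub>R v))"
    if "0 \<le> s" "s \<le> t" "0 \<le> s'" "s' \<le> t" for s s'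
    by (rule smooth_on_has_derivative[OF f inU[OF that]])
  have dh: "(h has_derivative (\<lambda>w. frechet_derivative f (at (x + s *\<^sub>R u + t *\<^sub>R v)) w
      - frechet_derivative f (at (x + s *\<^sub>R u)) w)) (at (x + s *\<^sub>R u))" if "0 \<le> s" "s \<le> t" for s
  proof -
    have "((\<lambda>y. y + t *\<^sub>R v) has_derivative (\<lambda>w. w)) (at (x + s *\<^sub>R u))"
      by (auto intro!: derivative_eq_intros)
    from has_derivative_compose[OF this df[of s t]] that t(1) df[of s 0] show ?thesis
      unfolding h_def by (intro has_derivative_diff) auto
  qed
  obtain s where s: "0 < s" "s < t" "h (x + t *\<^sub>R u) - h x = t * frechet_derivative h (at (x + s *\<^sub>R u)) u"
    by (rule mean_value_direction[OF t(1), of h x u]) (use dh in \<open>auto simp: differentiable_def\<close>)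
  obtain s' where s': "0 < s'" "s' < t"
    "frechet_derivative f (at (x + s *\<^sub>R u + t *\<^sub>R v)) u - frechet_derivative f (at (x + s *\<^sub>R u)) u
      = t * frechet_derivative (\<lambda>y. frechet_derivative f (at y) u) (at (x + s *\<^sub>R u + s' *\<^sub>R v)) v"
    by (rule mean_value_direction[OF t(1), of "\<lambda>y. frechet_derivative f (at y) u" "x + s *\<^sub>R u" v])
      (use smooth_on_differentiable[OF smooth_on_frechet_derivative[OF f] inU] s in auto)
  have "h (x + t *\<^sub>R u) - h x = t * (t * frechet_derivative (\<lambda>y. frechet_derivative f (at y) u)
      (at (x + s *\<^sub>R u + s' *\<^sub>R v)) v)"
    using s frechet_derivative_eqI[OF dh[of s]] s'(3) by simp
  then show thesis
    using s s' ball[of s s'] by (intro that[of "x + s *\<^sub>R u + s' *\<^sub>R v"]) (simp_all add: h_def algebra_simps)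
qed

text \<open>The second difference is symmetric in \<open>u\<close> and \<open>v\<close>, so one
  mixed derivative at some \<open>y\<close> equals the other at some \<open>z\<close>, both as close
  to \<open>x\<close> as desired. If the two differed at \<open>x\<close>, continuity would keep
  each within half of the gap of its value at \<open>x\<close>, and they could not meet.\<close>

lemma second_derivative_symmetric_real:
  fixes f :: "'e::euclidean_space \<Rightarrow> real"
  assumes U: "open U" "x \<in> U" and f: "smooth_on U f"
  shows "frechet_derivative (\<lambda>y. frechet_derivative f (at y) u) (at x) v =
    frechet_derivative (\<lambda>y. frechet_derivative f (at y) v) (at x) u"
proof (rule ccontr)
  define a b where "a = (\<lambda>x. frechet_derivative (\<lambda>y. frechet_derivative f (at y) u) (at x) v)"
    and "b = (\<lambda>x. frechet_derivative (\<lambda>y. frechet_derivative f (at y) v) (at x) u)"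
  assume "\<not> ?thesis"
  then have ne: "a x - b x \<noteq> 0" by (simp add: a_def b_def)
  have "isCont a x" "isCont b x"
    unfolding a_def b_def by (rule smooth_on_isCont[OF smooth_on_frechet_derivative[OF
          smooth_on_frechet_derivative[OF f]] U(2)])+
  then have lim: "(a \<longlongrightarrow> a x) (nhds x)" "(b \<longlongrightarrow> b x) (nhds x)"
    by (simp_all add: isCont_def tendsto_at_iff_tendsto_nhds)
  have "\<forall>\<^sub>F y in nhds x. dist (a y) (a x) < \<bar>a x - b x\<bar> / 2" "\<forall>\<^sub>F y in nhds x. dist (b y) (b x) < \<bar>a x - b x\<bar> / 2"
    using tendstoD[OF lim(1), of "\<bar>a x - b x\<bar> / 2"] tendstoD[OF lim(2), of "\<bar>a x - b x\<bar> / 2"] ne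
    by simp_all
  moreover have "\<forall>\<^sub>F y in nhds x. y \<in> U" using U by (rule eventually_nhds_in_open)
  ultimately have "\<forall>\<^sub>F y in nhds x. dist (a y) (a x) < \<bar>a x - b x\<bar> / 2 \<and> dist (b y) (b x) < \<bar>a x - b x\<bar> / 2 \<and> y \<in> U"
    by eventually_elim auto
  then obtain r where r: "r > 0" "\<And>y. y \<in> ball x r \<Longrightarrow> dist (a y) (a x) < \<bar>a x - b x\<bar> / 2"
      "\<And>y. y \<in> ball x r \<Longrightarrow> dist (b y) (b x) < \<bar>a x - b x\<bar> / 2" "ball x r \<subseteq> U"
    unfolding eventually_nhds_metric by (auto simp: subset_iff dist_commute[of x])
  define m where "m = norm u + norm v"
  \<comment> \<open>\<open>m + 1\<close> keeps the denominator positive when both directions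
    vanish.\<close>
  define t where "t = r / (2 * (m + 1))"
  have m: "0 \<le> m" by (simp add: m_def)
  then have t: "0 < t" using r(1) by (simp add: t_def)
  have "t * m < t * (2 * (m + 1))" using t m by (intro mult_strict_left_mono) auto
  also have "\<dots> = r" using m by (simp add: t_def)
  finally have tr: "t * (norm u + norm v) < r" by (simp add: m_def)
  obtain y where y: "y \<in> ball x r"
    "f (x + t *\<^sub>R u + t *\<^sub>R v) - f (x + t *\<^sub>R u) - f (x + t *\<^sub>R v) + f x = t * t * a y"
    unfolding a_def by (rule second_difference[OF U(1) f r(4) t tr])
  obtain z where z: "z \<in> ball x r"
    "f (x + t *\<^sub>R v + t *\<^sub>R u) - f (x + t *\<^sub>R v) - f (x + t *\<^sub>R u) + f x = t * t * b z"
    unfolding b_def using second_difference[OF U(1) f r(4) t, of v u] tr by (auto simp: add.commute)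
  have "t * t * a y = t * t * b z" using y(2) z(2) by (simp add: algebra_simps)
  then have "a y = b z" using t by simp
  with r(2)[OF y(1)] r(3)[OF z(1)] show False by (simp add: dist_real_def abs_if split: if_splits)
qed

lemma second_derivative_symmetric:
  fixes f :: "'e::euclidean_space \<Rightarrow> 'f::euclidean_space"
  assumes U: "open U" "x \<in> U" and f: "smooth_on U f"
  shows "frechet_derivative (\<lambda>y. frechet_derivative f (at y) u) (at x) v =
    frechet_derivative (\<lambda>y. frechet_derivative f (at y) v) (at x) u"
proof (rule euclidean_eqI)
  fix c :: 'f assume "c \<in> Basis"
  have inner: "frechet_derivative (\<lambda>y. h y \<bullet> c) (at y) w = frechet_derivative h (at y) w \<bullet> c"
    if "smooth_on U h" "y \<in> U" for h :: "'e \<Rightarrow> 'f" and y w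
    by (simp add: frechet_derivative_eqI[OF has_derivative_inner_left[OF smooth_on_has_derivative[OF that]]])
  have fc: "smooth_on U (\<lambda>y. f y \<bullet> c)"
    by (rule smooth_on_inner[OF U(1) f smooth_on_const])
  have "frechet_derivative (\<lambda>y. frechet_derivative f (at y) u) (at x) v \<bullet> c =
      frechet_derivative (\<lambda>y. frechet_derivative (\<lambda>y. f y \<bullet> c) (at y) u) (at x) v" for u v
  proof -
    have "frechet_derivative (\<lambda>y. frechet_derivative (\<lambda>y. f y \<bullet> c) (at y) u) (at x) =
      frechet_derivative (\<lambda>y. frechet_derivative f (at y) u \<bullet> c) (at x)"
      by (rule frechet_derivative_transform_within_open[OF
            smooth_on_differentiable[OF smooth_on_frechet_derivative[OF fc] U(2)] U])
        (simp add: inner[OF f])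
    then show ?thesis by (simp add: inner[OF smooth_on_frechet_derivative[OF f] U(2)])
  qed
  then show "frechet_derivative (\<lambda>y. frechet_derivative f (at y) u) (at x) v \<bullet> c =
    frechet_derivative (\<lambda>y. frechet_derivative f (at y) v) (at x) u \<bullet> c"
    by (simp add: second_derivative_symmetric_real[OF U fc, of u v])
qed

section \<open>Smooth local inverses\<close>

text \<open>The inverse function theorem yields a differentiable inverse \<open>g\<close>. Its
  derivative in direction \<open>v\<close> solves a linear system whose operator is the derivative
  of \<open>f\<close> at \<open>g y\<close>, as regular as \<open>g\<close> itself; so each pass
  through \<open>Ck_on_linear_solve\<close> gains one degree.\<close>

lemma smooth_local_inverse:
  fixes f :: "'h::euclidean_space \<Rightarrow> 'h"
  assumes U: "open U" "x \<in> U" and f: "smooth_on U f" and inj: "inj (frechet_derivative f (at x))"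
  obtains U' V g where "open U'" "x \<in> U'" "U' \<subseteq> U" "open V" "f ` U' = V" "g ` V = U'"
    "\<And>x. x \<in> U' \<Longrightarrow> g (f x) = x" "smooth_on V g"
proof -
  define f' where "f' y = Blinfun (frechet_derivative f (at y))" for y
  have f': "blinfun_apply (f' y) = frechet_derivative f (at y)" if "y \<in> U" for y
    unfolding f'_def
    by (rule bounded_linear_Blinfun_apply[OF has_derivative_bounded_linear[OF smooth_on_has_derivative[OF f that]]])
  have cont: "continuous_on U f'"
  proof (rule continuous_on_blinfun_componentwise)
    fix b :: 'h
    have "continuous_on U (\<lambda>y. frechet_derivative f (at y) b)"
      by (rule smooth_on_continuous_on[OF smooth_on_frechet_derivative[OF f]])
    then show "continuous_on U (\<lambda>y. blinfun_apply (f' y) b)"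
      by (simp add: f' cong: continuous_on_cong)
  qed
  have lin: "linear (frechet_derivative f (at x))"
    by (rule has_derivative_linear[OF smooth_on_has_derivative[OF f U(2)]])
  obtain M where M: "linear M" "M \<circ> frechet_derivative f (at x) = id"
    using linear_injective_left_inverse[OF lin inj] by blast
  have id: "Blinfun M o\<^sub>L f' x = id_blinfun"
    using M by (intro blinfun_eqI)
      (simp add: f'[OF U(2)] bounded_linear_Blinfun_apply linear_conv_bounded_linear pointfree_idE)
  have "(f has_derivative blinfun_apply (f' y)) (at y)" if "y \<in> U" for y
    using smooth_on_has_derivative[OF f that] by (simp add: f'[OF that])
  from inverse_function_theorem[OF U(1) this cont U(2) id]
  obtain U' V g g' where g: "open U'" "U' \<subseteq> U" "x \<in> U'" "open V" "homeomorphism U' V f g"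
    "\<And>y. y \<in> V \<Longrightarrow> (g has_derivative (g' y)) (at y)"
    "\<And>y. y \<in> V \<Longrightarrow> g' y = inv (blinfun_apply (f' (g y)))"
    "\<And>y. y \<in> V \<Longrightarrow> bij (blinfun_apply (f' (g y)))"
    by metis
  have gU: "g y \<in> U" if "y \<in> V" for y
    using g(2,5) that by (auto simp: homeomorphism_def)
  have solve: "frechet_derivative f (at (g y)) (g' y v) = v" if "y \<in> V" for y v
    using g(7,8)[OF that] f'[OF gU[OF that]] by (simp add: bij_is_surj surj_f_inv_f)
  have "Ck_on k V g" for k
  proof (induction k)
    case 0
    then show ?case using g(5) by (simp add: homeomorphism_def)
  next
    case (Suc k)
    show ?case
    proof (rule Ck_on_SucI[OF g(4,6)])
      fix v
      show "Ck_on k V (\<lambda>y. g' y v)"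
      proof (rule Ck_on_linear_solve[where L = "\<lambda>y. frechet_derivative f (at (g y))" and b = "\<lambda>_. v",
            OF g(4) _ _ solve _ Ck_on_const])
        show "linear (frechet_derivative f (at (g y)))" if "y \<in> V" for y
          by (rule has_derivative_linear[OF smooth_on_has_derivative[OF f gU[OF that]]])
        show "inj (frechet_derivative f (at (g y)))" if "y \<in> V" for y
          using g(8)[OF that] by (simp add: f'[OF gU[OF that]] bij_is_inj)
        have "Ck_on k U (\<lambda>y. frechet_derivative f (at y) w)" for w
          using smooth_on_frechet_derivative[OF f] by (simp add: smooth_on_def)
        from Ck_on_compose[OF g(4) _ this Suc, unfolded comp_def]
        show "Ck_on k V (\<lambda>y. frechet_derivative f (at (g y)) w)" for w
          using gU by blast
      qed
    qed
  qed
  then have "smooth_on V g" by (simp add: smooth_on_def)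
  with g show thesis by (intro that[of U' V g]) (auto simp: homeomorphism_def)
qed

section \<open>Bump functions\<close>

text \<open>The classical exp(-1/t), extended by 0, with negative powers of t as extra factors. They
  make the family closed under differentiation, so one induction over all \<open>n\<close> gives
  smoothness, also at 0.\<close>

definition flat :: "nat \<Rightarrow> real \<Rightarrow> real" where
  "flat n t = (if 0 < t then exp (- inverse t) * inverse t ^ n else 0)"

lemma tendsto_flat_0: "(flat n \<longlongrightarrow> 0) (at_right 0)"
proof -
  have "((\<lambda>t. inverse t ^ n / exp (inverse t)) \<longlongrightarrow> 0) (at_right (0::real))"
    by (rule filterlim_compose[OF tendsto_power_div_exp_0 filterlim_inverse_at_top_right])
  then show ?thesis
    by (rule Lim_transform_eventually)
      (auto simp: flat_def eventually_at_filter exp_minus field_simps)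
qed

lemma DERIV_flat: "(flat n has_real_derivative (flat (n + 2) t - real n * flat (n + 1) t)) (at t)"
proof -
  consider "t < 0" | "t = 0" | "t > 0" by linarith
  then show ?thesis
  proof cases
    case 1
    have "((\<lambda>_. 0) has_real_derivative 0) (at t)" by simp
    then have "(flat n has_real_derivative 0) (at t)"
      by (rule has_field_derivative_transform_within_open[of _ _ _ "{..<0}"]) (use 1 in \<open>auto simp: flat_def\<close>)
    then show ?thesis using 1 by (simp add: flat_def)
  next
    case 2
    \<comment> \<open>For positive \<open>h\<close> the difference quotient
      \<open>flat n h / h\<close> is \<open>flat (Suc n) h\<close>, again a member of the
      family.\<close>
    have r: "((\<lambda>h. flat n h / h) \<longlongrightarrow> 0) (at_right 0)"
      by (rule Lim_transform_eventually[OF tendsto_flat_0[of "Suc n"]])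
        (auto simp: flat_def eventually_at_filter field_simps)
    have l: "((\<lambda>h. flat n h / h) \<longlongrightarrow> 0) (at_left 0)"
      by (rule Lim_transform_eventually[OF tendsto_const]) (auto simp: flat_def eventually_at_filter)
    have "((\<lambda>h. flat n h / h) \<longlongrightarrow> 0) (at 0)" by (rule filterlim_split_at[OF l r])
    then show ?thesis using 2 by (simp add: DERIV_def flat_def)
  next
    case 3
    have "((\<lambda>t. exp (- inverse t) * inverse t ^ n) has_real_derivative
       (flat (n + 2) t - real n * flat (n + 1) t)) (at t)"
      using 3 by (cases n) (auto intro!: derivative_eq_intros simp: flat_def field_simps power2_eq_square,
          metis One_nat_def power_eq_if)
    then show ?thesis
      by (rule has_field_derivative_transform_within_open[of _ _ _ "{0<..}"]) (use 3 in \<open>auto simp: flat_def\<close>)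
  qed
qed

lemma smooth_on_flat: "smooth_on UNIV (flat n)"
proof -
  have "Ck_on k UNIV (flat n)" for k
  proof (induction k arbitrary: n)
    case 0
    show ?case using DERIV_flat by (auto intro!: continuous_at_imp_continuous_on DERIV_isCont)
  next
    case (Suc k)
    have "Ck_on k UNIV (\<lambda>t. - real n * flat (n + 1) t)"
      by (rule Ck_on_bilinear[OF bounded_bilinear_mult open_UNIV Ck_on_const Suc])
    from Ck_on_bilinear[OF bounded_bilinear_mult open_UNIV
        Ck_on_add[OF open_UNIV Suc[of "n + 2"] this] Ck_on_const]
    have "Ck_on k UNIV (\<lambda>t. (flat (n + 2) t - real n * flat (n + 1) t) * v)" for v
      by simp
    then show ?case
      by (intro Ck_on_SucI[OF open_UNIV DERIV_flat[THEN has_field_derivative_imp_has_derivative]])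
  qed
  then show ?thesis by (simp add: smooth_on_def)
qed

text \<open>\<open>a\<close> is positive exactly inside the ball of radius \<open>r\<close>,
  \<open>b\<close> exactly outside the closed ball of radius \<open>r / 2\<close>. These regions
  cover the space, so \<open>a / (a + b)\<close> has no pole; it is 1 where \<open>b\<close>
  vanishes and 0 where \<open>a\<close> does.\<close>

lemma smooth_bump:
  fixes x :: "'e::euclidean_space"
  assumes "0 < r"
  obtains \<phi> :: "'e \<Rightarrow> real" where "smooth_on UNIV \<phi>" "\<And>y. y \<in> ball x (r / 2) \<Longrightarrow> \<phi> y = 1"
    "\<And>y. y \<notin> ball x r \<Longrightarrow> \<phi> y = 0"
proof -
  define q where "q y = (y - x) \<bullet> (y - x)" for y
  have dist: "q y = (dist x y)\<^sup>2" for y by (simp add: q_def dist_norm norm_minus_commute[of x] power2_norm_eq_inner)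
  define a b where "a y = flat 0 (r\<^sup>2 - q y)" and "b y = flat 0 (q y - (r / 2)\<^sup>2)" for y
  define \<phi> where "\<phi> y = a y / (a y + b y)" for y
  have id: "smooth_on UNIV (\<lambda>y. y - x)"
    by (rule smooth_on_diff[OF open_UNIV smooth_on_bounded_linear[OF bounded_linear_ident] smooth_on_const]) simp
  have q: "smooth_on UNIV q"
    unfolding q_def by (rule smooth_on_inner[OF open_UNIV id id])
  have a: "smooth_on UNIV a"
    using smooth_on_compose[OF open_UNIV _ smooth_on_flat smooth_on_diff[OF open_UNIV smooth_on_const q], of "r\<^sup>2" 0]
    by (simp add: a_def[abs_def] comp_def)
  have b: "smooth_on UNIV b"
    using smooth_on_compose[OF open_UNIV _ smooth_on_flat smooth_on_diff[OF open_UNIV q smooth_on_const], of "(r / 2)\<^sup>2" 0]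
    by (simp add: b_def[abs_def] comp_def)
  have pos: "a y + b y > 0" for y
  proof -
    have "(r / 2)\<^sup>2 < r\<^sup>2" using assms by (simp add: power2_eq_square)
    then have "r\<^sup>2 - q y > 0 \<or> q y - (r / 2)\<^sup>2 > 0" by linarith
    then show ?thesis by (auto simp: a_def b_def flat_def add_pos_pos)
  qed
  have "smooth_on UNIV \<phi>"
  \<comment> \<open>The quotient is smooth as the solution of a one-dimensional linear system with
    injective coefficient \<open>a y + b y\<close>.\<close>
  proof (rule smooth_on_linear_solve[where L = "\<lambda>y z. (a y + b y) * z"])
    show "smooth_on UNIV (\<lambda>y. (a y + b y) * z)" for z
      by (intro smooth_on_mult smooth_on_add a b smooth_on_const open_UNIV)
    show "inj (\<lambda>z. (a y + b y) * z)" for y using pos[of y] by (simp add: inj_on_def)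
    show "(a y + b y) * \<phi> y = a y" for y using pos[of y] by (simp add: \<phi>_def)
  qed (auto intro: linear_times a)
  moreover have "\<phi> y = 1" if "y \<in> ball x (r / 2)" for y
  proof -
    have "q y < (r / 2)\<^sup>2" unfolding dist using that assms by (intro power_strict_mono) auto
    then have "b y = 0" by (simp add: b_def flat_def)
    then show ?thesis using pos[of y] by (simp add: \<phi>_def)
  qed
  moreover have "\<phi> y = 0" if "y \<notin> ball x r" for y
  proof -
    have "q y \<ge> r\<^sup>2" unfolding dist using that assms by (intro power_mono) auto
    then show ?thesis by (simp add: \<phi>_def a_def flat_def)
  qed
  ultimately show thesis by (rule that)
qed

section \<open>Charts and vector fields\<close>

lemma chart_inv_left: "is_chart c \<Longrightarrow> p \<in> fst c \<Longrightarrow> chart_inv c (snd c p) = p"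
  by (simp add: is_chart_def homeomorphism_def)

lemma chart_inv_in: "x \<in> snd c ` fst c \<Longrightarrow> chart_inv c x \<in> fst c"
  by (simp add: chart_inv_def inv_into_into)

lemma open_chart_image:
  assumes "is_chart c" "open U"
  shows "open (snd c ` (fst c \<inter> U))"
proof -
  have "snd c ` (fst c \<inter> U) = chart_inv c -` U \<inter> snd c ` fst c"
    using assms(1) by (auto simp: chart_inv_left)
  moreover have "continuous_on (snd c ` fst c) (chart_inv c)" "open (snd c ` fst c)"
    using assms(1) by (auto simp: is_chart_def homeomorphism_def)
  ultimately show ?thesis using assms(2) continuous_on_open_vimage by metis
qed

lemma continuous_on_chart_inv: "is_chart c \<Longrightarrow> continuous_on (snd c ` fst c) (chart_inv c)"
  by (simp add: is_chart_def homeomorphism_def)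

lemma isCont_chart_inv: "is_chart c \<Longrightarrow> x \<in> snd c ` fst c \<Longrightarrow> isCont (chart_inv c) x"
  by (metis is_chart_def homeomorphism_def continuous_on_eq_continuous_at)

text \<open>The chain rule for a map passing through a point of a manifold, with the intermediate
  variable read in \<open>d\<close>. Continuity of \<open>k\<close> makes the factorisation through
  \<open>d\<close> valid near \<open>y\<close> and not only at \<open>y\<close>. Coordinate changes,
  the inclusion in charts and pullbacks of functions are all instances.\<close>

lemma has_derivative_through_chart:
  fixes k :: "'y::real_normed_vector \<Rightarrow> 'a::topological_space"
    and d :: "('a, 'e::euclidean_space) chart" and h :: "'a \<Rightarrow> 'z::real_normed_vector"
  assumes "is_chart d" "isCont k y" "k y \<in> fst d"
    and "(h \<circ> chart_inv d) differentiable (at (snd d (k y)))" "(snd d \<circ> k) differentiable (at y)"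
  shows "((h \<circ> k) has_derivative (\<lambda>v. frechet_derivative (h \<circ> chart_inv d) (at (snd d (k y)))
    (frechet_derivative (snd d \<circ> k) (at y) v))) (at y)"
proof -
  have "(h \<circ> chart_inv d has_derivative frechet_derivative (h \<circ> chart_inv d) (at (snd d (k y))))
      (at ((snd d \<circ> k) y))"
    using frechet_derivative_has_derivative[OF assms(4)] by simp
  from has_derivative_compose[OF frechet_derivative_has_derivative[OF assms(5)] this]
  have *: "((\<lambda>x. (h \<circ> chart_inv d) ((snd d \<circ> k) x)) has_derivative
      (\<lambda>v. frechet_derivative (h \<circ> chart_inv d) (at (snd d (k y)))
        (frechet_derivative (snd d \<circ> k) (at y) v))) (at y)" .
  have "\<forall>\<^sub>F x in at y. k x \<in> fst d"
    using assms(1-3) topological_tendstoD[of k "k y" "at y" "fst d"] by (auto simp: isCont_def is_chart_def)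
  then have "\<forall>\<^sub>F x in at y. (h \<circ> chart_inv d) ((snd d \<circ> k) x) = (h \<circ> k) x"
    by eventually_elim (simp add: chart_inv_left[OF assms(1)])
  then show ?thesis
    by (rule has_derivative_transform_eventually[OF *]) (simp_all add: chart_inv_left[OF assms(1,3)])
qed

section \<open>Jacobians of coordinate changes\<close>

text \<open>\<open>to_chart\<close> and \<open>of_chart\<close> are both Jacobians of this kind,
  with the chosen chart at \<open>p\<close> on one side; the cocycle rule for general charts covers
  every combination of them.\<close>

definition chart_change ::
  "('a, 'e::euclidean_space) chart \<Rightarrow> ('a, 'e) chart \<Rightarrow> 'a \<Rightarrow> 'e \<Rightarrow> 'e" where
  "chart_change c d p = frechet_derivative (snd d \<circ> chart_inv c) (at (snd c p))"

lemma to_chart_eq: "to_chart A c p = chart_change (chart_at A p) c p"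
  by (simp add: fun_eq_iff to_chart_def chart_change_def)

lemma of_chart_eq: "of_chart A c p = chart_change c (chart_at A p) p"
  by (simp add: fun_eq_iff of_chart_def chart_change_def)

text \<open>If \<open>w\<close> vanishes off a compact part of the chart, this is a smooth field on
  the whole manifold, as the arguments of a connection have to be.\<close>

definition chart_field ::
  "('a, 'e::euclidean_space) chart set \<Rightarrow> ('a, 'e) chart \<Rightarrow> ('e \<Rightarrow> 'e) \<Rightarrow> 'a \<Rightarrow> 'e" where
  "chart_field A c w p = (if p \<in> fst c then of_chart A c p (w (snd c p)) else 0)"

definition chart_fun :: "('a, 'e) chart \<Rightarrow> ('e \<Rightarrow> real) \<Rightarrow> 'a \<Rightarrow> real" where
  "chart_fun c f p = (if p \<in> fst c then f (snd c p) else 0)"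

locale manifold =
  fixes A :: "('a::{t2_space,second_countable_topology}, 'e::euclidean_space) chart set"
  assumes atlas: "smooth_atlas A"
begin

lemma is_chart: "c \<in> A \<Longrightarrow> is_chart c"
  using atlas by (simp add: smooth_atlas_def)

lemma open_chart: "c \<in> A \<Longrightarrow> open (fst c)"
  using is_chart by (auto simp: is_chart_def)

lemma open_image: "c \<in> A \<Longrightarrow> open (snd c ` fst c)"
  using is_chart by (auto simp: is_chart_def)

lemma chart_at: "chart_at A p \<in> A" "p \<in> fst (chart_at A p)"
proof -
  have "\<exists>c. c \<in> A \<and> p \<in> fst c" using atlas unfolding smooth_atlas_def by blast
  from someI_ex[OF this] show "chart_at A p \<in> A" "p \<in> fst (chart_at A p)"
    unfolding chart_at_def by blast+
qed

lemma open_overlap: "c \<in> A \<Longrightarrow> d \<in> A \<Longrightarrow> open (snd c ` (fst c \<inter> fst d))"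
  by (rule open_chart_image[OF is_chart open_chart])

lemma smooth_transition:
  "c \<in> A \<Longrightarrow> d \<in> A \<Longrightarrow> smooth_on (snd c ` (fst c \<inter> fst d)) (snd d \<circ> chart_inv c)"
  using atlas by (simp add: smooth_atlas_def)

lemma differentiable_transition:
  assumes "c \<in> A" "d \<in> A" "p \<in> fst c" "p \<in> fst d"
  shows "(snd d \<circ> chart_inv c) differentiable (at (snd c p))"
  by (rule smooth_on_differentiable[OF smooth_transition[OF assms(1,2)]]) (use assms in auto)

lemma linear_chart_change:
  "c \<in> A \<Longrightarrow> d \<in> A \<Longrightarrow> p \<in> fst c \<Longrightarrow> p \<in> fst d \<Longrightarrow> linear (chart_change c d p)"
  unfolding chart_change_def
  by (rule has_derivative_linear[OF frechet_derivative_has_derivative[OF differentiable_transition]])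

lemma chart_change_chart_change:
  assumes c: "c \<in> A" "p \<in> fst c" and d: "d \<in> A" "p \<in> fst d" and e: "e \<in> A" "p \<in> fst e"
  shows "chart_change d e p (chart_change c d p v) = chart_change c e p v"
proof -
  have inv: "chart_inv c (snd c p) = p" by (rule chart_inv_left[OF is_chart[OF c(1)] c(2)])
  have "(snd e \<circ> chart_inv c has_derivative (\<lambda>v. frechet_derivative (snd e \<circ> chart_inv d) (at (snd d (chart_inv c (snd c p))))
    (frechet_derivative (snd d \<circ> chart_inv c) (at (snd c p)) v))) (at (snd c p))"
  proof (rule has_derivative_through_chart)
    show "isCont (chart_inv c) (snd c p)"
      using is_chart c by (intro isCont_chart_inv) auto
  qed (use assms is_chart differentiable_transition inv in auto)
  from frechet_derivative_eqI[OF this] show ?thesis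
    by (simp add: chart_change_def inv)
qed

lemma chart_change_self:
  assumes c: "c \<in> A" "p \<in> fst c"
  shows "chart_change c c p v = v"
proof -
  have "((\<lambda>x. x) has_derivative (\<lambda>x. x)) (at (snd c p))" by (rule has_derivative_ident)
  then have "(snd c \<circ> chart_inv c has_derivative (\<lambda>x. x)) (at (snd c p))"
    by (rule has_derivative_transform_within_open[OF _ open_image[OF c(1)]])
      (use c in \<open>auto simp: chart_inv_left[OF is_chart]\<close>)
  from frechet_derivative_eqI[OF this] show ?thesis by (simp add: chart_change_def)
qed

lemma of_chart_to_chart: "c \<in> A \<Longrightarrow> p \<in> fst c \<Longrightarrow> of_chart A c p (to_chart A c p v) = v"
  by (simp add: to_chart_eq of_chart_eq chart_change_chart_change chart_change_self chart_at)

lemma linear_to_chart: "c \<in> A \<Longrightarrow> p \<in> fst c \<Longrightarrow> linear (to_chart A c p)"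
  by (simp add: to_chart_eq linear_chart_change chart_at)

lemma linear_of_chart: "c \<in> A \<Longrightarrow> p \<in> fst c \<Longrightarrow> linear (of_chart A c p)"
  by (simp add: of_chart_eq linear_chart_change chart_at)

lemma vf_rep_at: "p \<in> fst c \<Longrightarrow> c \<in> A \<Longrightarrow> vf_rep A c X (snd c p) = to_chart A c p (X p)"
  by (simp add: vf_rep_def chart_inv_left is_chart)

lemma vf_rep_add:
  "c \<in> A \<Longrightarrow> x \<in> snd c ` fst c \<Longrightarrow> vf_rep A c (\<lambda>r. X r + Y r) x = vf_rep A c X x + vf_rep A c Y x"
  by (simp add: vf_rep_def linear_add[OF linear_to_chart] chart_inv_in)

lemma vf_rep_scale:
  "c \<in> A \<Longrightarrow> x \<in> snd c ` fst c \<Longrightarrow>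
    vf_rep A c (\<lambda>r. f r *\<^sub>R X r) x = (f \<circ> chart_inv c) x *\<^sub>R vf_rep A c X x"
  by (simp add: vf_rep_def linear_scale[OF linear_to_chart] chart_inv_in)

section \<open>Vector fields and functions: algebra and extension by zero\<close>

lemma smooth_vf_rep: "X \<in> vector_fields A \<Longrightarrow> c \<in> A \<Longrightarrow> smooth_on (snd c ` fst c) (vf_rep A c X)"
  by (simp add: vector_fields_def smooth_vf_on_def)

lemma vector_fieldsI:
  "(\<And>c. c \<in> A \<Longrightarrow> smooth_on (snd c ` fst c) (vf_rep A c X)) \<Longrightarrow> X \<in> vector_fields A"
  by (simp add: vector_fields_def smooth_vf_on_def)

lemma vector_fields_add:
  assumes "X \<in> vector_fields A" "Y \<in> vector_fields A"
  shows "(\<lambda>r. X r + Y r) \<in> vector_fields A"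
proof (rule vector_fieldsI)
  fix c assume c: "c \<in> A"
  show "smooth_on (snd c ` fst c) (vf_rep A c (\<lambda>r. X r + Y r))"
    by (rule smooth_on_cong[OF open_image[OF c] vf_rep_add[OF c, symmetric]
          smooth_on_add[OF open_image[OF c] smooth_vf_rep[OF assms(1) c] smooth_vf_rep[OF assms(2) c]]])
qed

lemma vector_fields_scale:
  assumes "smooth_fun A f" "X \<in> vector_fields A"
  shows "(\<lambda>r. f r *\<^sub>R X r) \<in> vector_fields A"
proof (rule vector_fieldsI)
  fix c assume c: "c \<in> A"
  have "smooth_on (snd c ` fst c) (f \<circ> chart_inv c)" using assms(1) c by (simp add: smooth_fun_def)
  from smooth_on_cong[OF open_image[OF c] vf_rep_scale[OF c, symmetric]
      smooth_on_scaleR[OF open_image[OF c] this smooth_vf_rep[OF assms(2) c]]]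
  show "smooth_on (snd c ` fst c) (vf_rep A c (\<lambda>r. f r *\<^sub>R X r))" .
qed

lemma vector_fields_zero: "(\<lambda>r. 0) \<in> vector_fields A"
proof (rule vector_fieldsI)
  fix c assume c: "c \<in> A"
  have "0 = vf_rep A c (\<lambda>r. 0) x" if "x \<in> snd c ` fst c" for x
    using that c by (simp add: vf_rep_def linear_0[OF linear_to_chart] chart_inv_in)
  from smooth_on_cong[OF open_image[OF c] this smooth_on_const]
  show "smooth_on (snd c ` fst c) (vf_rep A c (\<lambda>r. 0))" .
qed

lemma vector_fields_sum:
  "(\<And>b. b \<in> I \<Longrightarrow> X b \<in> vector_fields A) \<Longrightarrow> (\<lambda>r. \<Sum>b\<in>I. X b r) \<in> vector_fields A"
  by (induction I rule: infinite_finite_induct) (simp_all add: vector_fields_zero vector_fields_add)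

lemma smooth_fun_const: "smooth_fun A (\<lambda>r. a)"
  by (simp add: smooth_fun_def comp_def smooth_on_const)

lemma smooth_fun_mult: "smooth_fun A f \<Longrightarrow> smooth_fun A h \<Longrightarrow> smooth_fun A (\<lambda>r. f r * h r)"
  using open_image by (auto simp: smooth_fun_def comp_def intro: smooth_on_mult)

text \<open>Extension by zero is smooth because the image of a compact set is closed in the (Hausdorff)
  manifold.\<close>

lemma smooth_on_extend_by_zero:
  assumes c: "c \<in> A" and d: "d \<in> A" and K: "compact K" "K \<subseteq> snd c ` fst c"
    and zero: "\<And>p. p \<in> fst d \<Longrightarrow> p \<notin> chart_inv c ` K \<Longrightarrow> f (snd d p) = 0"
    and smooth: "smooth_on (snd d ` (fst d \<inter> fst c)) f"
  shows "smooth_on (snd d ` fst d) f"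
proof -
  have "continuous_on K (chart_inv c)"
    by (rule continuous_on_subset[OF continuous_on_chart_inv[OF is_chart[OF c]] K(2)])
  then have cl: "closed (chart_inv c ` K)"
    using K(1) by (intro compact_imp_closed compact_continuous_image)
  have sub: "chart_inv c ` K \<subseteq> fst c" by (auto intro!: chart_inv_in subsetD[OF K(2)])
  have o: "open (snd d ` (fst d \<inter> - chart_inv c ` K))"
    using cl by (intro open_chart_image is_chart d) auto
  have "smooth_on (snd d ` (fst d \<inter> - chart_inv c ` K)) f"
    by (rule smooth_on_cong[OF o _ smooth_on_const[of _ 0]]) (use zero in auto)
  from smooth_on_Un[OF open_overlap[OF d c] o smooth this]
  have "smooth_on (snd d ` (fst d \<inter> fst c) \<union> snd d ` (fst d \<inter> - chart_inv c ` K)) f" .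
  moreover have "(fst d \<inter> fst c) \<union> (fst d \<inter> - chart_inv c ` K) = fst d"
    using sub by blast
  ultimately show ?thesis by (simp flip: image_Un)
qed

lemma smooth_compose_transition:
  assumes c: "c \<in> A" and d: "d \<in> A" and "smooth_on (snd c ` (fst c \<inter> fst d)) f"
  shows "smooth_on (snd d ` (fst d \<inter> fst c)) (f \<circ> (snd c \<circ> chart_inv d))"
  by (rule smooth_on_compose[OF open_overlap[OF d c] _ assms(3) smooth_transition[OF d c]])
    (auto simp: chart_inv_left[OF is_chart[OF d]])

lemma chart_fun_smooth:
  assumes c: "c \<in> A" and K: "compact K" "K \<subseteq> snd c ` fst c"
    and f: "smooth_on (snd c ` fst c) f" "\<And>x. x \<in> snd c ` fst c \<Longrightarrow> x \<notin> K \<Longrightarrow> f x = 0"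
  shows "smooth_fun A (chart_fun c f)"
  unfolding smooth_fun_def
proof
  fix d assume d: "d \<in> A"
  show "smooth_on (snd d ` fst d) (chart_fun c f \<circ> chart_inv d)"
  proof (rule smooth_on_extend_by_zero[OF c d K])
    fix p assume p: "p \<in> fst d" "p \<notin> chart_inv c ` K"
    have "f (snd c p) = 0" if "p \<in> fst c"
      using that p(2) f(2) chart_inv_left[OF is_chart[OF c] that] by force
    then show "(chart_fun c f \<circ> chart_inv d) (snd d p) = 0"
      by (simp add: chart_inv_left is_chart d p chart_fun_def)
  next
    have "smooth_on (snd c ` (fst c \<inter> fst d)) f"
      using f(1) by (rule smooth_on_subset) auto
    from smooth_compose_transition[OF c d this]
    show "smooth_on (snd d ` (fst d \<inter> fst c)) (chart_fun c f \<circ> chart_inv d)"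
      by (rule smooth_on_cong[OF open_overlap[OF d c], rotated])
        (auto simp: chart_fun_def chart_inv_left is_chart d)
  qed
qed

text \<open>On the overlap with another chart \<open>d\<close> the components are the Jacobian from
  \<open>c\<close> to \<open>d\<close> evaluated on \<open>w\<close>, both composed with the
  transition from \<open>d\<close> to \<open>c\<close>; each ingredient is smooth. Away from the
  compact set \<open>K\<close> they vanish.\<close>

lemma chart_field_vector_field:
  assumes c: "c \<in> A" and K: "compact K" "K \<subseteq> snd c ` fst c"
    and w: "smooth_on (snd c ` fst c) w" "\<And>x. x \<in> snd c ` fst c \<Longrightarrow> x \<notin> K \<Longrightarrow> w x = 0"
  shows "chart_field A c w \<in> vector_fields A"
proof (rule vector_fieldsI)
  fix d assume d: "d \<in> A"
  show "smooth_on (snd d ` fst d) (vf_rep A d (chart_field A c w))"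
  proof (rule smooth_on_extend_by_zero[OF c d K])
    fix p assume p: "p \<in> fst d" "p \<notin> chart_inv c ` K"
    have "w (snd c p) = 0" if "p \<in> fst c"
      using that p(2) w(2) chart_inv_left[OF is_chart[OF c] that] by force
    then show "vf_rep A d (chart_field A c w) (snd d p) = 0"
      by (simp add: vf_rep_at p d chart_field_def linear_0 linear_of_chart linear_to_chart c)
  next
    have "smooth_on (snd c ` (fst c \<inter> fst d)) w"
      using w(1) by (rule smooth_on_subset) auto
    from smooth_compose_transition[OF c d this]
    have w': "smooth_on (snd d ` (fst d \<inter> fst c)) (w \<circ> (snd c \<circ> chart_inv d))" .
    have D: "smooth_on (snd d ` (fst d \<inter> fst c))
        ((\<lambda>x. frechet_derivative (snd d \<circ> chart_inv c) (at x) v) \<circ> (snd c \<circ> chart_inv d))" for v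
      by (rule smooth_compose_transition[OF c d smooth_on_frechet_derivative[OF smooth_transition[OF c d]]])
    have lin: "linear (chart_change c d (chart_inv d x))" if "x \<in> snd d ` (fst d \<inter> fst c)" for x
      using that by (auto simp: chart_inv_left is_chart d intro: linear_chart_change c)
    from smooth_on_apply_linear[OF open_overlap[OF d c] lin _ w', unfolded chart_change_def] D
    have "smooth_on (snd d ` (fst d \<inter> fst c))
        (\<lambda>x. chart_change c d (chart_inv d x) (w (snd c (chart_inv d x))))"
      by (simp add: comp_def chart_change_def)
    then show "smooth_on (snd d ` (fst d \<inter> fst c)) (vf_rep A d (chart_field A c w))"
      by (rule smooth_on_cong[OF open_overlap[OF d c], rotated])
        (auto simp: chart_field_def vf_rep_at chart_inv_left is_chart d to_chart_eq of_chart_eq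
          chart_change_chart_change c chart_at)
  qed
qed

text \<open>By definition a smooth tensor is smooth on coordinate fields.
  \<open>smooth_on_apply_linear\<close>, applied to one slot at a time, replaces these by the
  components of \<open>W\<close> and then of \<open>V\<close>.\<close>

lemma smooth_metric_chart:
  assumes g: "bilinear_field A g" and W: "V \<in> vector_fields A" "W \<in> vector_fields A" and c: "c \<in> A"
  shows "smooth_on (snd c ` fst c) ((\<lambda>r. g r (V r) (W r)) \<circ> chart_inv c)"
proof -
  let ?U = "snd c ` fst c"
  note o = open_image[OF c]
  define G where "G x u v = g (chart_inv c x) (of_chart A c (chart_inv c x) u) (of_chart A c (chart_inv c x) v)" for x u v
  have bil: "bilinear (g p)" for p using g by (simp add: bilinear_field_def)
  have lin1: "linear (\<lambda>u. G x u v)" and lin2: "linear (G x u)" if "x \<in> ?U" for x u v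
    using bil[of "chart_inv c x"] linear_of_chart[OF c chart_inv_in[OF that]]
      linear_compose[of "of_chart A c (chart_inv c x)" "\<lambda>u. g (chart_inv c x) u (of_chart A c (chart_inv c x) v)"]
      linear_compose[of "of_chart A c (chart_inv c x)" "g (chart_inv c x) (of_chart A c (chart_inv c x) u)"]
    by (simp_all add: bilinear_def comp_def G_def[abs_def])
  have "smooth_on ?U (\<lambda>x. G x u v)" for u v
    using g c by (simp add: bilinear_field_def G_def Let_def)
  from smooth_on_apply_linear[OF o lin2 this smooth_vf_rep[OF W(2) c]]
  have "smooth_on ?U (\<lambda>x. G x u (vf_rep A c W x))" for u .
  from smooth_on_apply_linear[where L = "\<lambda>x u. G x u (vf_rep A c W x)", OF o lin1 this smooth_vf_rep[OF W(1) c]]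
  have "smooth_on ?U (\<lambda>x. G x (vf_rep A c V x) (vf_rep A c W x))" .
  then show ?thesis
    by (rule smooth_on_cong[OF o, rotated])
      (simp add: G_def vf_rep_def of_chart_to_chart c chart_inv_in)
qed

end

section \<open>Affine connections\<close>

context manifold
begin

lemma connection_add_left:
  "affine_connection A D \<Longrightarrow> X \<in> vector_fields A \<Longrightarrow> X' \<in> vector_fields A \<Longrightarrow> Y \<in> vector_fields A \<Longrightarrow>
    D (\<lambda>r. X r + X' r) Y p = D X Y p + D X' Y p"
  by (simp add: affine_connection_def)

lemma connection_add_right:
  "affine_connection A D \<Longrightarrow> X \<in> vector_fields A \<Longrightarrow> Y \<in> vector_fields A \<Longrightarrow> Y' \<in> vector_fields A \<Longrightarrow>
    D X (\<lambda>r. Y r + Y' r) p = D X Y p + D X Y' p"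
  by (simp add: affine_connection_def)

lemma connection_scale_left:
  "affine_connection A D \<Longrightarrow> smooth_fun A f \<Longrightarrow> X \<in> vector_fields A \<Longrightarrow> Y \<in> vector_fields A \<Longrightarrow>
    D (\<lambda>r. f r *\<^sub>R X r) Y p = f p *\<^sub>R D X Y p"
  unfolding affine_connection_def by blast

lemma connection_scale_right:
  "affine_connection A D \<Longrightarrow> smooth_fun A f \<Longrightarrow> X \<in> vector_fields A \<Longrightarrow> Y \<in> vector_fields A \<Longrightarrow>
    D X (\<lambda>r. f r *\<^sub>R Y r) p = dir_deriv A p (X p) f *\<^sub>R Y p + f p *\<^sub>R D X Y p"
  unfolding affine_connection_def by blast

lemma connection_sum_left:
  assumes D: "affine_connection A D" and Y: "Y \<in> vector_fields A"
    and fE: "finite I" "\<And>b. b \<in> I \<Longrightarrow> smooth_fun A (f b)" "\<And>b. b \<in> I \<Longrightarrow> E b \<in> vector_fields A"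
  shows "D (\<lambda>r. \<Sum>b\<in>I. f b r *\<^sub>R E b r) Y p = (\<Sum>b\<in>I. f b p *\<^sub>R D (E b) Y p)"
  using fE
proof (induction I rule: finite_induct)
  case empty
  \<comment> \<open>The zero field is treated as 0 times a vector field.\<close>
  show ?case using connection_scale_left[OF D smooth_fun_const[of 0] Y Y, of p] by simp
next
  case (insert b I)
  have b: "smooth_fun A (f b)" "E b \<in> vector_fields A" using insert.prems by auto
  have S: "(\<lambda>r. \<Sum>b\<in>I. f b r *\<^sub>R E b r) \<in> vector_fields A"
    using insert.prems by (intro vector_fields_sum vector_fields_scale) auto
  show ?case
    using insert by (simp add: connection_add_left[OF D vector_fields_scale[OF b] S Y]
        connection_scale_left[OF D b Y])
qed

lemma connection_sum_right:
  assumes D: "affine_connection A D" and X: "X \<in> vector_fields A"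
    and fE: "finite I" "\<And>b. b \<in> I \<Longrightarrow> smooth_fun A (f b)" "\<And>b. b \<in> I \<Longrightarrow> E b \<in> vector_fields A"
  shows "D X (\<lambda>r. \<Sum>b\<in>I. f b r *\<^sub>R E b r) p =
    (\<Sum>b\<in>I. dir_deriv A p (X p) (f b) *\<^sub>R E b p + f b p *\<^sub>R D X (E b) p)"
  using fE
proof (induction I rule: finite_induct)
  case empty
  \<comment> \<open>Additivity applied to 0 = 0 + 0; scaling by 0 would bring in a Leibniz
    term.\<close>
  show ?case
    using connection_add_right[OF D X vector_fields_zero vector_fields_zero, of p] by simp
next
  case (insert b I)
  have b: "smooth_fun A (f b)" "E b \<in> vector_fields A" using insert.prems by auto
  have S: "(\<lambda>r. \<Sum>b\<in>I. f b r *\<^sub>R E b r) \<in> vector_fields A"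
    using insert.prems by (intro vector_fields_sum vector_fields_scale) auto
  show ?case
    using insert by (simp add: connection_add_right[OF D X vector_fields_scale[OF b] S]
        connection_scale_right[OF D b(1) X b(2)])
qed

lemma dir_deriv_locally_const:
  assumes "open U" "p \<in> U" "\<And>r. r \<in> U \<Longrightarrow> f r = a"
  shows "dir_deriv A p v f = 0"
proof -
  let ?c = "chart_at A p"
  have "((\<lambda>x. a) has_derivative (\<lambda>_. 0)) (at (snd ?c p))" by (rule has_derivative_const)
  then have "(f \<circ> chart_inv ?c has_derivative (\<lambda>_. 0)) (at (snd ?c p))"
    by (rule has_derivative_transform_within_open[OF _ open_chart_image[OF is_chart[OF chart_at(1)] assms(1)]])
      (use assms chart_at(2) in \<open>auto simp: chart_inv_left is_chart chart_at(1)\<close>)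
  from frechet_derivative_eqI[OF this] show ?thesis by (simp add: dir_deriv_def)
qed

text \<open>With a cut-off function \<open>\<rho>\<close> and the coordinate frame, \<open>\<rho>\<^sup>2 W = \<Sum> (\<rho> W\<^sup>b) (\<rho> E\<^sub>b)\<close>,
  and all the factors on the right are globally defined.\<close>

lemma connection_in_frame:
  assumes D: "affine_connection A D"
  obtains coef :: "('a \<Rightarrow> 'e) \<Rightarrow> 'e \<Rightarrow> 'a \<Rightarrow> real" and E :: "'e \<Rightarrow> 'a \<Rightarrow> 'e"
  where "\<And>W b. W \<in> vector_fields A \<Longrightarrow> smooth_fun A (coef W b)"
    and "\<And>W W' b r. W r = W' r \<Longrightarrow> coef W b r = coef W' b r"
    and "\<And>V W. V \<in> vector_fields A \<Longrightarrow> W \<in> vector_fields A \<Longrightarrow>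
      D V W p = (\<Sum>b\<in>Basis. coef V b p *\<^sub>R D (E b) W p)"
    and "\<And>V W. V \<in> vector_fields A \<Longrightarrow> W \<in> vector_fields A \<Longrightarrow>
      D V W p = (\<Sum>b\<in>Basis. dir_deriv A p (V p) (coef W b) *\<^sub>R E b p + coef W b p *\<^sub>R D V (E b) p)"
proof -
  define c where "c = chart_at A p"
  have c: "c \<in> A" "p \<in> fst c" by (simp_all add: c_def chart_at)
  let ?U = "snd c ` fst c"
  note o = open_image[OF c(1)]
  obtain r where r: "r > 0" "cball (snd c p) r \<subseteq> ?U"
    using open_contains_cball[of ?U] o c(2) by blast
  obtain \<phi> :: "'e \<Rightarrow> real" where phi: "smooth_on UNIV \<phi>" "\<And>y. y \<in> ball (snd c p) (r / 2) \<Longrightarrow> \<phi> y = 1"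
    "\<And>y. y \<notin> ball (snd c p) r \<Longrightarrow> \<phi> y = 0" using smooth_bump[OF r(1)] by blast
  have phiU: "smooth_on ?U \<phi>" using phi(1) by (rule smooth_on_subset) simp
  have zero: "\<phi> y = 0" if "y \<notin> cball (snd c p) r" for y using that phi(3)[of y] by auto
  define \<rho> where "\<rho> = chart_fun c \<phi>"
  define E where "E b = chart_field A c (\<lambda>x. \<phi> x *\<^sub>R b)" for b
  define coef where "coef W b = chart_fun c (\<lambda>x. \<phi> x * (vf_rep A c W x \<bullet> b))" for W b
  have rho: "smooth_fun A \<rho>"
    unfolding \<rho>_def by (rule chart_fun_smooth[OF c(1) compact_cball r(2) phiU zero])
  have E: "E b \<in> vector_fields A" for b
    unfolding E_def
    by (rule chart_field_vector_field[OF c(1) compact_cball r(2) smooth_on_scaleR[OF o phiU smooth_on_const]])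
      (simp add: zero)
  have coef: "smooth_fun A (coef W b)" if "W \<in> vector_fields A" for W b
    unfolding coef_def
    by (rule chart_fun_smooth[OF c(1) compact_cball r(2) smooth_on_mult[OF o phiU
            smooth_on_inner[OF o smooth_vf_rep[OF that c(1)] smooth_on_const]]]) (simp add: zero)
  have eq: "(\<lambda>r. (\<rho> r * \<rho> r) *\<^sub>R W r) = (\<lambda>r. \<Sum>b\<in>Basis. coef W b r *\<^sub>R E b r)" for W
  proof
    fix r
    show "(\<rho> r * \<rho> r) *\<^sub>R W r = (\<Sum>b\<in>Basis. coef W b r *\<^sub>R E b r)"
    proof (cases "r \<in> fst c")
      case True
      note lin = linear_of_chart[OF c(1) True]
      have "(\<Sum>b\<in>Basis. coef W b r *\<^sub>R E b r) =
        (\<phi> (snd c r) * \<phi> (snd c r)) *\<^sub>R (\<Sum>b\<in>Basis. (to_chart A c r (W r) \<bullet> b) *\<^sub>R of_chart A c r b)"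
        using True by (simp add: coef_def E_def chart_fun_def chart_field_def vf_rep_at c(1)
            linear_scale[OF lin] scaleR_sum_right mult_ac)
      also have "(\<Sum>b\<in>Basis. (to_chart A c r (W r) \<bullet> b) *\<^sub>R of_chart A c r b) = W r"
        by (simp add: linear_sum_Basis[OF lin, symmetric] of_chart_to_chart c(1) True)
      finally show ?thesis using True by (simp add: \<rho>_def chart_fun_def)
    qed (simp add: \<rho>_def coef_def chart_fun_def)
  qed
  have rho_p: "\<rho> p = 1" using r(1) c(2) by (simp add: \<rho>_def chart_fun_def phi(2))
  note rho2 = smooth_fun_mult[OF rho rho]
  \<comment> \<open>The cut-off is constant on this neighbourhood of \<open>p\<close>, so the
    Leibniz term of \<open>\<rho> r * \<rho> r\<close> vanishes at \<open>p\<close> and multiplying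
    a field by this function leaves \<open>D V W p\<close> unchanged.\<close>
  define O' where "O' = snd c -` ball (snd c p) (r / 2) \<inter> fst c"
  have "continuous_on (fst c) (snd c)" using is_chart[OF c(1)] by (simp add: is_chart_def homeomorphism_def)
  then have O': "open O'" "p \<in> O'" unfolding O'_def
    using open_chart[OF c(1)] r(1) c(2) by (auto simp: continuous_on_open_vimage)
  have "dir_deriv A p v (\<lambda>r. \<rho> r * \<rho> r) = 0" for v
    by (rule dir_deriv_locally_const[OF O', of _ 1]) (auto simp: O'_def \<rho>_def chart_fun_def phi(2))
  then have right: "D V (\<lambda>r. (\<rho> r * \<rho> r) *\<^sub>R W r) p = D V W p"
    if "V \<in> vector_fields A" "W \<in> vector_fields A" for V W
    using connection_scale_right[OF D rho2 that] by (simp add: rho_p)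
  have left: "D (\<lambda>r. (\<rho> r * \<rho> r) *\<^sub>R V r) W p = D V W p"
    if "V \<in> vector_fields A" "W \<in> vector_fields A" for V W
    using connection_scale_left[OF D rho2 that] by (simp add: rho_p)
  show thesis
  proof (rule that[of coef E])
    show "smooth_fun A (coef W b)" if "W \<in> vector_fields A" for W b by (rule coef[OF that])
    \<comment> \<open>\<open>coef W b r\<close> reads only \<open>W r\<close>; hence two fields that
      agree along the hypersurface have equal coefficients there.\<close>
    show "coef W b r = coef W' b r" if "W r = W' r" for W W' b r
      using that by (simp add: coef_def chart_fun_def vf_rep_at c(1))
    show "D V W p = (\<Sum>b\<in>Basis. coef V b p *\<^sub>R D (E b) W p)"
      if "V \<in> vector_fields A" "W \<in> vector_fields A" for V W
      using left[OF that] connection_sum_left[OF D that(2) finite_Basis coef[OF that(1)] E, of "\<lambda>b. b"]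
      by (simp add: eq)
    show "D V W p = (\<Sum>b\<in>Basis. dir_deriv A p (V p) (coef W b) *\<^sub>R E b p + coef W b p *\<^sub>R D V (E b) p)"
      if "V \<in> vector_fields A" "W \<in> vector_fields A" for V W
      using right[OF that] connection_sum_right[OF D that(1) finite_Basis coef[OF that(2)] E, of "\<lambda>b. b"]
      by (simp add: eq)
  qed
qed

end

section \<open>Immersions\<close>

lemma has_derivative_apply_derivative:
  fixes f :: "'h::euclidean_space \<Rightarrow> 'e::euclidean_space"
  assumes U: "open U" "x \<in> U" and f: "smooth_on U f" and y: "(\<eta> has_derivative \<eta>') (at x)"
  shows "((\<lambda>y. frechet_derivative f (at y) (\<eta> y)) has_derivative
    (\<lambda>h. frechet_derivative f (at x) (\<eta>' h) +
      frechet_derivative (\<lambda>y. frechet_derivative f (at y) h) (at x) (\<eta> x))) (at x)"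
proof -
  let ?S = "\<lambda>u h. frechet_derivative (\<lambda>y. frechet_derivative f (at y) u) (at x) h"
  have lin: "linear (frechet_derivative f (at y))" if "y \<in> U" for y
    by (rule has_derivative_linear[OF smooth_on_has_derivative[OF f that]])
  have S: "((\<lambda>y. frechet_derivative f (at y) u) has_derivative ?S u) (at x)" for u
    by (rule smooth_on_has_derivative[OF smooth_on_frechet_derivative[OF f] U(2)])
  have "((\<lambda>y. \<Sum>b\<in>Basis. (\<eta> y \<bullet> b) *\<^sub>R frechet_derivative f (at y) b) has_derivative
      (\<lambda>h. \<Sum>b\<in>Basis. (\<eta> x \<bullet> b) *\<^sub>R ?S b h + (\<eta>' h \<bullet> b) *\<^sub>R frechet_derivative f (at x) b)) (at x)"
    by (intro has_derivative_sum has_derivative_scaleR has_derivative_inner_left S y)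
  then have d: "((\<lambda>y. frechet_derivative f (at y) (\<eta> y)) has_derivative
      (\<lambda>h. \<Sum>b\<in>Basis. (\<eta> x \<bullet> b) *\<^sub>R ?S b h + (\<eta>' h \<bullet> b) *\<^sub>R frechet_derivative f (at x) b)) (at x)"
    by (rule has_derivative_transform_within_open[OF _ U]) (simp add: linear_sum_Basis[OF lin, symmetric])
  \<comment> \<open>Symmetry of the second derivative moves \<open>b\<close> into the slot in which
    linearity is known, and the sum over the basis collapses to
    \<open>?S h (\<eta> x)\<close>.\<close>
  have "(\<Sum>b\<in>Basis. (\<eta> x \<bullet> b) *\<^sub>R ?S b h + (\<eta>' h \<bullet> b) *\<^sub>R frechet_derivative f (at x) b) =
      frechet_derivative f (at x) (\<eta>' h) + ?S h (\<eta> x)" for h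
    unfolding second_derivative_symmetric[OF U f, of _ h] sum.distrib
    by (simp add: linear_sum_Basis[OF lin[OF U(2)], symmetric]
        linear_sum_Basis[OF has_derivative_linear[OF S], symmetric])
  with d show ?thesis by simp
qed

text \<open>\<open>v\<close> and \<open>w\<close> are controlled only on the image of
  \<open>f\<close>, but each is differentiated only along the other, hence in a direction tangent to
  the image, where the chain rule applies. Both terms then acquire the same second derivative of
  \<open>f\<close>, by symmetry, and it cancels in the difference.\<close>

lemma bracket_of_related_fields:
  fixes f :: "'h::euclidean_space \<Rightarrow> 'e::euclidean_space"
  assumes U: "open U" "x \<in> U" and f: "smooth_on U f"
    and d: "\<xi> differentiable (at x)" "\<eta> differentiable (at x)" "v differentiable (at (f x))" "w differentiable (at (f x))"
    and v: "\<And>y. y \<in> U \<Longrightarrow> v (f y) = frechet_derivative f (at y) (\<xi> y)"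
    and w: "\<And>y. y \<in> U \<Longrightarrow> w (f y) = frechet_derivative f (at y) (\<eta> y)"
  shows "frechet_derivative w (at (f x)) (v (f x)) - frechet_derivative v (at (f x)) (w (f x)) =
    frechet_derivative f (at x) (frechet_derivative \<eta> (at x) (\<xi> x) - frechet_derivative \<xi> (at x) (\<eta> x))"
proof -
  let ?S = "\<lambda>u h. frechet_derivative (\<lambda>y. frechet_derivative f (at y) u) (at x) h"
  have lin: "linear (frechet_derivative f (at x))"
    by (rule has_derivative_linear[OF smooth_on_has_derivative[OF f U(2)]])
  have D: "frechet_derivative w (at (f x)) (frechet_derivative f (at x) h) =
      frechet_derivative f (at x) (frechet_derivative \<eta> (at x) h) + ?S h (\<eta> x)"
    if d: "\<eta> differentiable (at x)" "w differentiable (at (f x))"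
      and w: "\<And>y. y \<in> U \<Longrightarrow> w (f y) = frechet_derivative f (at y) (\<eta> y)" for w :: "'e \<Rightarrow> 'e" and \<eta> h
  proof -
    have "((\<lambda>y. w (f y)) has_derivative
        (\<lambda>h. frechet_derivative w (at (f x)) (frechet_derivative f (at x) h))) (at x)"
      by (rule has_derivative_compose[OF smooth_on_has_derivative[OF f U(2)] frechet_derivative_has_derivative[OF d(2)]])
    moreover have "((\<lambda>y. w (f y)) has_derivative
      (\<lambda>h. frechet_derivative f (at x) (frechet_derivative \<eta> (at x) h) + ?S h (\<eta> x))) (at x)"
      by (rule has_derivative_transform_within_open[OF has_derivative_apply_derivative[OF U f
              frechet_derivative_has_derivative[OF d(1)]] U]) (simp add: w)
    ultimately show ?thesis by (rule fun_cong[OF has_derivative_unique])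
  qed
  have "frechet_derivative w (at (f x)) (v (f x)) =
      frechet_derivative f (at x) (frechet_derivative \<eta> (at x) (\<xi> x)) + ?S (\<xi> x) (\<eta> x)"
    unfolding v[OF U(2)] by (rule D[OF d(2,4) w])
  moreover have "frechet_derivative v (at (f x)) (w (f x)) =
      frechet_derivative f (at x) (frechet_derivative \<xi> (at x) (\<eta> x)) + ?S (\<eta> x) (\<xi> x)"
    unfolding w[OF U(2)] by (rule D[OF d(1,3) v])
  ultimately show ?thesis
    by (simp add: linear_diff[OF lin] second_derivative_symmetric[OF U f, of "\<xi> x" "\<eta> x"])
qed

section \<open>The differential of an immersion in charts\<close>

text \<open>\<open>map_diff\<close> uses the charts chosen at each point, which may jump as the
  point varies; smoothness arguments need the differential in one fixed pair of charts.\<close>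

definition chart_diff ::
  "('b \<Rightarrow> 'a) \<Rightarrow> ('b, 'h::euclidean_space) chart \<Rightarrow> ('a, 'e::euclidean_space) chart \<Rightarrow> 'b \<Rightarrow> 'h \<Rightarrow> 'e" where
  "chart_diff i c' c q = frechet_derivative (snd c \<circ> i \<circ> chart_inv c') (at (snd c' q))"

lemma map_diff_eq: "map_diff A' A i q = chart_diff i (chart_at A' q) (chart_at A (i q)) q"
  by (simp add: fun_eq_iff map_diff_def chart_diff_def)

locale immersion = M: manifold A + N: manifold A'
  for A :: "('a::{t2_space,second_countable_topology}, 'e::euclidean_space) chart set"
    and A' :: "('b::{t2_space,second_countable_topology}, 'h::euclidean_space) chart set" +
  fixes i :: "'b \<Rightarrow> 'a"
  assumes smooth_i: "smooth_map A' A i" and inj_map_diff: "inj (map_diff A' A i q)"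
begin

abbreviation di :: "'b \<Rightarrow> 'h \<Rightarrow> 'e" where "di \<equiv> map_diff A' A i"

lemma continuous_i: "continuous_on UNIV i"
  using smooth_i by (simp add: smooth_map_def)

lemma open_preimage: "open V \<Longrightarrow> open (i -` V)"
  by (rule open_vimage[OF _ continuous_i])

abbreviation chart_dom :: "('b, 'h) chart \<Rightarrow> ('a, 'e) chart \<Rightarrow> 'h set" where
  "chart_dom c' c \<equiv> snd c' ` (fst c' \<inter> i -` fst c)"

lemma open_dom: "c' \<in> A' \<Longrightarrow> c \<in> A \<Longrightarrow> open (chart_dom c' c)"
  by (intro open_chart_image N.is_chart open_preimage M.open_chart)

lemma smooth_on_dom: "c' \<in> A' \<Longrightarrow> c \<in> A \<Longrightarrow> smooth_on (chart_dom c' c) (snd c \<circ> i \<circ> chart_inv c')"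
  using smooth_i by (simp add: smooth_map_def)

lemma differentiable_dom:
  assumes "c' \<in> A'" "c \<in> A" "q \<in> fst c'" "i q \<in> fst c"
  shows "(snd c \<circ> i \<circ> chart_inv c') differentiable (at (snd c' q))"
  by (rule smooth_on_differentiable[OF smooth_on_dom[OF assms(1,2)]]) (use assms in auto)

lemma linear_chart_diff:
  assumes "c' \<in> A'" "c \<in> A" "q \<in> fst c'" "i q \<in> fst c"
  shows "linear (chart_diff i c' c q)"
  unfolding chart_diff_def
  by (rule has_derivative_linear[OF frechet_derivative_has_derivative[OF differentiable_dom[OF assms]]])

lemma linear_di: "linear (di q)"
  unfolding map_diff_eq by (intro linear_chart_diff M.chart_at N.chart_at)

lemma isCont_i_chart_inv:
  assumes "c' \<in> A'" "q \<in> fst c'" shows "isCont (i \<circ> chart_inv c') (snd c' q)"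
  unfolding comp_def
proof (rule isCont_o2[where f = "chart_inv c'" and g = i])
  show "isCont (chart_inv c') (snd c' q)"
    using assms by (intro isCont_chart_inv N.is_chart) auto
  show "isCont i (chart_inv c' (snd c' q))"
    using continuous_i by (simp add: continuous_on_eq_continuous_at)
qed

text \<open>Both sides are the derivative of \<open>snd d \<circ> i \<circ> chart_inv c'\<close>,
  factored through \<open>d'\<close> on the hypersurface and through \<open>c\<close> on the ambient
  manifold.\<close>

lemma chart_diff_change:
  assumes c': "c' \<in> A'" "q \<in> fst c'" and d': "d' \<in> A'" "q \<in> fst d'" and c: "c \<in> A" "i q \<in> fst c" and d: "d \<in> A" "i q \<in> fst d"
  shows "chart_diff i d' d q (chart_change c' d' q u) = chart_change c d (i q) (chart_diff i c' c q u)"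
proof -
  have inv: "chart_inv c' (snd c' q) = q" by (rule chart_inv_left[OF N.is_chart[OF c'(1)] c'(2)])
  have "(snd d \<circ> i \<circ> chart_inv c' has_derivative
    (\<lambda>v. frechet_derivative (snd d \<circ> i \<circ> chart_inv d') (at (snd d' (chart_inv c' (snd c' q))))
      (frechet_derivative (snd d' \<circ> chart_inv c') (at (snd c' q)) v))) (at (snd c' q))"
  proof (rule has_derivative_through_chart)
    show "isCont (chart_inv c') (snd c' q)"
      using c' by (intro isCont_chart_inv N.is_chart) auto
  qed (use assms N.is_chart N.differentiable_transition differentiable_dom inv in auto)
  from frechet_derivative_eqI[OF this]
  have 1: "chart_diff i d' d q (chart_change c' d' q u) = chart_diff i c' d q u"
    by (simp add: chart_change_def chart_diff_def inv)
  have "(snd d \<circ> (i \<circ> chart_inv c') has_derivative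
    (\<lambda>v. frechet_derivative (snd d \<circ> chart_inv c) (at (snd c ((i \<circ> chart_inv c') (snd c' q))))
      (frechet_derivative (snd c \<circ> (i \<circ> chart_inv c')) (at (snd c' q)) v))) (at (snd c' q))"
    by (rule has_derivative_through_chart)
      (use assms M.is_chart M.differentiable_transition differentiable_dom inv isCont_i_chart_inv
        in \<open>auto simp flip: comp_assoc\<close>)
  from frechet_derivative_eqI[OF this]
  have 2: "chart_change c d (i q) (chart_diff i c' c q u) = chart_diff i c' d q u"
    by (simp add: chart_change_def chart_diff_def inv comp_assoc)
  from 1 2 show ?thesis by simp
qed

lemma to_chart_di:
  assumes "c' \<in> A'" "q \<in> fst c'" "c \<in> A" "i q \<in> fst c"
  shows "to_chart A c (i q) (di q u) = chart_diff i c' c q (to_chart A' c' q u)"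
  unfolding to_chart_eq map_diff_eq
  by (rule chart_diff_change[symmetric]) (simp_all add: assms M.chart_at N.chart_at)

lemma dir_deriv_di:
  assumes "(f \<circ> chart_inv (chart_at A (i q))) differentiable (at (snd (chart_at A (i q)) (i q)))"
  shows "dir_deriv A (i q) (di q u) f = dir_deriv A' q u (f \<circ> i)"
proof -
  let ?c' = "chart_at A' q" and ?c = "chart_at A (i q)"
  have inv: "chart_inv ?c' (snd ?c' q) = q" by (rule chart_inv_left[OF N.is_chart[OF N.chart_at(1)] N.chart_at(2)])
  have "(f \<circ> (i \<circ> chart_inv ?c') has_derivative
    (\<lambda>v. frechet_derivative (f \<circ> chart_inv ?c) (at (snd ?c ((i \<circ> chart_inv ?c') (snd ?c' q))))
      (frechet_derivative (snd ?c \<circ> (i \<circ> chart_inv ?c')) (at (snd ?c' q)) v))) (at (snd ?c' q))"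
    by (rule has_derivative_through_chart)
      (use assms M.is_chart M.chart_at N.chart_at differentiable_dom inv isCont_i_chart_inv
        in \<open>auto simp flip: comp_assoc\<close>)
  from frechet_derivative_eqI[OF this] show ?thesis
    by (simp add: dir_deriv_def map_diff_def inv comp_assoc)
qed

lemma dir_deriv_di_smooth: "smooth_fun A f \<Longrightarrow> dir_deriv A (i q) (di q u) f = dir_deriv A' q u (f \<circ> i)"
  using M.chart_at[of "i q"] by (intro dir_deriv_di smooth_on_differentiable) (auto simp: smooth_fun_def)

end

lemma (in manifold) dir_deriv_cong:
  assumes U: "open U" "p \<in> U" and eq: "\<And>r. r \<in> U \<Longrightarrow> f r = h r"
    and f: "(f \<circ> chart_inv (chart_at A p)) differentiable (at (snd (chart_at A p) p))"
  shows "dir_deriv A p v f = dir_deriv A p v h"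
proof -
  let ?c = "chart_at A p"
  have "frechet_derivative (f \<circ> chart_inv ?c) (at (snd ?c p)) = frechet_derivative (h \<circ> chart_inv ?c) (at (snd ?c p))"
    by (rule frechet_derivative_transform_within_open[OF f open_chart_image[OF is_chart[OF chart_at(1)] U(1)]])
      (use U(2) eq chart_at(2) in \<open>auto simp: chart_inv_left is_chart chart_at(1)\<close>)
  then show ?thesis by (simp add: dir_deriv_def)
qed

context immersion
begin

lemma differentiable_comp_i:
  assumes "(f \<circ> chart_inv (chart_at A (i q))) differentiable (at (snd (chart_at A (i q)) (i q)))"
  shows "(f \<circ> i \<circ> chart_inv (chart_at A' q)) differentiable (at (snd (chart_at A' q) q))"
proof -
  let ?c' = "chart_at A' q" and ?c = "chart_at A (i q)"
  have inv: "chart_inv ?c' (snd ?c' q) = q" by (rule chart_inv_left[OF N.is_chart[OF N.chart_at(1)] N.chart_at(2)])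
  have "(f \<circ> (i \<circ> chart_inv ?c') has_derivative
    (\<lambda>v. frechet_derivative (f \<circ> chart_inv ?c) (at (snd ?c ((i \<circ> chart_inv ?c') (snd ?c' q))))
      (frechet_derivative (snd ?c \<circ> (i \<circ> chart_inv ?c')) (at (snd ?c' q)) v))) (at (snd ?c' q))"
    by (rule has_derivative_through_chart)
      (use assms M.is_chart M.chart_at N.chart_at differentiable_dom inv isCont_i_chart_inv
        in \<open>auto simp flip: comp_assoc\<close>)
  then show ?thesis by (auto simp: differentiable_def comp_assoc)
qed

section \<open>Extensions of fields of the hypersurface\<close>

lemma extends_nearD:
  assumes "extends_near A' A i q X V"
  shows "V \<in> vector_fields A" "V (i q) = di q (X q)"
  using assms by (auto simp: extends_near_def)

text \<open>An extension is obtained by composing with a local left inverse of the immersion: if the linear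
  map P is a left inverse of the differential at q, then P followed by the inverse of the local
  diffeomorphism \<open>P \<circ> i\<close> is one.\<close>

lemma extension_exists:
  assumes X: "X \<in> vector_fields A'"
  shows "\<exists>V. extends_near A' A i q X V"
proof -
  define c' where "c' = chart_at A' q"
  define c where "c = chart_at A (i q)"
  have c': "c' \<in> A'" "q \<in> fst c'" and c: "c \<in> A" "i q \<in> fst c"
    by (simp_all add: c'_def c_def M.chart_at N.chart_at)
  define f where "f = snd c \<circ> i \<circ> chart_inv c'"
  define x where "x = snd c' q"
  let ?O = "chart_dom c' c"
  have O: "open ?O" "x \<in> ?O" using open_dom[OF c'(1) c(1)] c'(2) c(2) by (auto simp: x_def)
  have f: "smooth_on ?O f" unfolding f_def by (rule smooth_on_dom[OF c'(1) c(1)])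
  have fx: "f (snd c' r) = snd c (i r)" if "r \<in> fst c'" for r
    by (simp add: f_def chart_inv_left[OF N.is_chart[OF c'(1)] that])
  have in_dom: "i r \<in> fst c" if r: "r \<in> fst c'" "snd c' r \<in> ?O" for r
  proof -
    obtain s where "s \<in> fst c'" "i s \<in> fst c" "snd c' r = snd c' s" using r(2) by auto
    then show ?thesis using chart_inv_left[OF N.is_chart[OF c'(1)]] r(1) by metis
  qed
  have Df: "frechet_derivative f (at x) = di q"
    by (simp add: f_def x_def map_diff_eq chart_diff_def c_def c'_def)
  obtain P where P: "linear P" "P \<circ> di q = id"
    using linear_injective_left_inverse[OF linear_di inj_map_diff] by blast
  have bP: "bounded_linear P" using P(1) by (simp add: linear_conv_bounded_linear)
  have sP: "smooth_on UNIV P" by (rule smooth_on_bounded_linear[OF bP open_UNIV])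
  have Pf: "smooth_on ?O (P \<circ> f)"
    by (rule smooth_on_compose[OF O(1) subset_UNIV sP f])
  have "(P \<circ> f has_derivative (\<lambda>h. P (frechet_derivative f (at x) h))) (at x)"
    unfolding comp_def by (rule bounded_linear.has_derivative[OF bP smooth_on_has_derivative[OF f O(2)]])
  then have "frechet_derivative (P \<circ> f) (at x) = id"
    using P(2) by (simp add: frechet_derivative_eqI Df comp_def id_def fun_eq_iff)
  then have "inj (frechet_derivative (P \<circ> f) (at x))" by simp
  from smooth_local_inverse[OF O Pf this]
  obtain U' V' G where G: "open U'" "x \<in> U'" "U' \<subseteq> ?O" "open V'" "(P \<circ> f) ` U' = V'" "G ` V' = U'"
    "\<And>x. x \<in> U' \<Longrightarrow> G ((P \<circ> f) x) = x" "smooth_on V' G" by metis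
  define \<xi> where "\<xi> = vf_rep A' c' X"
  have "smooth_on (snd c' ` fst c') \<xi>" unfolding \<xi>_def by (rule N.smooth_vf_rep[OF X c'(1)])
  then have xi: "smooth_on ?O \<xi>" by (rule smooth_on_subset) auto
  \<comment> \<open>The pushed-forward field in the chart \<open>c\<close>, as a function of the
    coordinates on the hypersurface.\<close>
  define F where "F y = frechet_derivative f (at y) (\<xi> y)" for y
  have F: "smooth_on ?O F" unfolding F_def
    by (rule smooth_on_apply_linear[OF O(1) _ smooth_on_frechet_derivative[OF f] xi])
      (rule has_derivative_linear[OF smooth_on_has_derivative[OF f]])
  have FG: "smooth_on V' (F \<circ> G)"
    by (rule smooth_on_compose[OF G(4) _ F G(8)]) (use G(3,6) in simp)
  let ?im = "snd c ` fst c"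
  have oN: "open (P -` V' \<inter> ?im)"
    using bP by (intro open_Int open_vimage G M.open_image c linear_continuous_on)
  have "P (f x) \<in> V'" using G(2,5) by auto
  moreover have "f x \<in> ?im" using fx[OF c'(2)] c(2) by (simp add: x_def)
  ultimately have "f x \<in> P -` V' \<inter> ?im" by simp
  then obtain r where r: "r > 0" "cball (f x) r \<subseteq> P -` V' \<inter> ?im"
    using open_contains_cball oN by blast
  obtain \<phi> :: "'e \<Rightarrow> real" where phi: "smooth_on UNIV \<phi>" "\<And>y. y \<in> ball (f x) (r / 2) \<Longrightarrow> \<phi> y = 1"
    "\<And>y. y \<notin> ball (f x) r \<Longrightarrow> \<phi> y = 0" using smooth_bump[OF r(1)] by blast
  \<comment> \<open>Apart from the cut-off, the candidate is constant along the fibres of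
    \<open>P\<close>, and \<open>G \<circ> P\<close> recovers the hypersurface coordinate from
    \<open>f\<close>. The cut-off makes it extendable to the whole manifold.\<close>
  define w where "w y = \<phi> y *\<^sub>R F (G (P y))" for y
  have "smooth_on (P -` V' \<inter> ?im) ((F \<circ> G) \<circ> P)"
    by (rule smooth_on_compose[OF oN _ FG smooth_on_subset[OF sP]]) auto
  from smooth_on_scaleR[OF oN smooth_on_subset[OF phi(1)] this]
  have w1: "smooth_on (P -` V' \<inter> ?im) w" by (simp add: w_def[abs_def] comp_def)
  have w0: "w y = 0" if "y \<notin> cball (f x) r" for y using that phi(3)[of y] by (auto simp: w_def)
  have o2: "open (?im - cball (f x) r)" by (intro open_Diff M.open_image c closed_cball)
  have "smooth_on (?im - cball (f x) r) w"
    by (rule smooth_on_cong[OF o2 _ smooth_on_const[of _ 0]]) (simp add: w0)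
  from smooth_on_Un[OF oN o2 w1 this]
  have w: "smooth_on ?im w" by (rule smooth_on_subset) (use r(2) in auto)
  define V where "V = chart_field A c w"
  have V: "V \<in> vector_fields A"
    unfolding V_def by (rule M.chart_field_vector_field[OF c(1) compact_cball _ w w0]) (use r(2) in auto)
  \<comment> \<open>Two conditions on a point of the hypersurface: \<open>G\<close> inverts
    \<open>P \<circ> f\<close> there, and its image lies where the cut-off is 1. Both are imposed in
    coordinates of the hypersurface, so other sheets near \<open>i q\<close> do not enter.\<close>
  define O2 where "O2 = f -` ball (f x) (r / 2) \<inter> U'"
  have O2: "open O2"
    unfolding O2_def using smooth_on_continuous_on[OF smooth_on_subset[OF f G(3)]] G(1) open_ball
    by (auto simp: continuous_on_open_vimage)
  define U where "U = snd c' -` O2 \<inter> fst c'"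
  have "continuous_on (fst c') (snd c')" using N.is_chart[OF c'(1)] by (simp add: is_chart_def homeomorphism_def)
  then have U: "open U"
    unfolding U_def using N.open_chart[OF c'(1)] O2 by (auto simp: continuous_on_open_vimage)
  have "q \<in> U" using c'(2) G(2) r(1) by (simp add: U_def O2_def x_def)
  moreover have "V (i s) = di s (X s)" if "s \<in> U" for s
  proof -
    have s: "s \<in> fst c'" "snd c' s \<in> U'" "f (snd c' s) \<in> ball (f x) (r / 2)"
      using that by (auto simp: U_def O2_def)
    have ic: "i s \<in> fst c" by (rule in_dom[OF s(1) subsetD[OF G(3) s(2)]])
    have "w (snd c (i s)) = F (snd c' s)"
      using phi(2)[OF s(3)] G(7)[OF s(2)] by (simp add: w_def fx[OF s(1), symmetric])
    also have "\<dots> = to_chart A c (i s) (di s (X s))"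
      by (simp add: to_chart_di[OF c'(1) s(1) c(1) ic] F_def chart_diff_def f_def \<xi>_def N.vf_rep_at s(1) c'(1))
    finally show ?thesis by (simp add: V_def chart_field_def ic M.of_chart_to_chart c(1))
  qed
  ultimately show ?thesis using U V unfolding extends_near_def by blast
qed

text \<open>With \<open>f\<close> the inclusion in the chosen charts at \<open>q\<close> and
  \<open>i q\<close>, which are the charts in which the brackets are computed, the components of the
  extensions are related by \<open>f\<close> to those of \<open>X\<close> and \<open>Y\<close> on a
  whole neighbourhood, as differentiation demands.\<close>

lemma lie_bracket_extension:
  assumes X: "X \<in> vector_fields A'" "extends_near A' A i q X V"
    and Y: "Y \<in> vector_fields A'" "extends_near A' A i q Y W"
  shows "lie_bracket A V W (i q) = di q (lie_bracket A' X Y q)"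
proof -
  define c' where "c' = chart_at A' q"
  define c where "c = chart_at A (i q)"
  have c': "c' \<in> A'" "q \<in> fst c'" and c: "c \<in> A" "i q \<in> fst c"
    by (simp_all add: c'_def c_def M.chart_at N.chart_at)
  obtain U1 U2 where U1: "open U1" "q \<in> U1" "\<And>r. r \<in> U1 \<Longrightarrow> V (i r) = di r (X r)"
    and U2: "open U2" "q \<in> U2" "\<And>r. r \<in> U2 \<Longrightarrow> W (i r) = di r (Y r)"
    using X(2) Y(2) unfolding extends_near_def by blast
  define f where "f = snd c \<circ> i \<circ> chart_inv c'"
  define x where "x = snd c' q"
  have fx: "f (snd c' r) = snd c (i r)" if "r \<in> fst c'" for r
    by (simp add: f_def chart_inv_left[OF N.is_chart[OF c'(1)] that])
  let ?O = "snd c' ` (fst c' \<inter> (i -` fst c \<inter> (U1 \<inter> U2)))"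
  have o: "open ?O"
    by (intro open_chart_image N.is_chart c' open_Int open_preimage M.open_chart c U1 U2)
  have x: "x \<in> ?O" using c' c U1 U2 by (auto simp: x_def)
  have f: "smooth_on ?O f"
    unfolding f_def by (rule smooth_on_subset[OF smooth_on_dom[OF c'(1) c(1)]]) auto
  have rel: "vf_rep A c V' (f y) = frechet_derivative f (at y) (vf_rep A' c' X' y)"
    if y: "y \<in> ?O" and eq: "\<And>r. r \<in> U1 \<inter> U2 \<Longrightarrow> V' (i r) = di r (X' r)" for V' X' y
  proof -
    obtain r where r: "y = snd c' r" "r \<in> fst c'" "i r \<in> fst c" "r \<in> U1 \<inter> U2" using y by auto
    have "vf_rep A c V' (f y) = to_chart A c (i r) (di r (X' r))"
      by (simp add: r(1) fx[OF r(2)] M.vf_rep_at r(3) c(1) eq[OF r(4)])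
    also have "\<dots> = frechet_derivative f (at y) (vf_rep A' c' X' y)"
      by (simp add: to_chart_di[OF c'(1) r(2) c(1) r(3)] chart_diff_def f_def r(1) N.vf_rep_at r(2) c'(1))
    finally show ?thesis .
  qed
  have fxc: "f x = snd c (i q)" using fx[OF c'(2)] by (simp add: x_def)
  have dX: "vf_rep A' c' X' differentiable (at x)" if "X' \<in> vector_fields A'" for X'
    by (rule smooth_on_differentiable[OF N.smooth_vf_rep[OF that c'(1)]]) (simp add: x_def c'(2))
  have dV: "vf_rep A c V' differentiable (at (f x))" if "V' \<in> vector_fields A" for V'
    by (rule smooth_on_differentiable[OF M.smooth_vf_rep[OF that c(1)]]) (simp add: fxc c(2))
  have "frechet_derivative (vf_rep A c W) (at (f x)) (vf_rep A c V (f x)) -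
      frechet_derivative (vf_rep A c V) (at (f x)) (vf_rep A c W (f x)) =
    frechet_derivative f (at x) (frechet_derivative (vf_rep A' c' Y) (at x) (vf_rep A' c' X x) -
      frechet_derivative (vf_rep A' c' X) (at x) (vf_rep A' c' Y x))"
    by (rule bracket_of_related_fields[OF o x f dX[OF X(1)] dX[OF Y(1)]
          dV[OF extends_nearD(1)[OF X(2)]] dV[OF extends_nearD(1)[OF Y(2)]]])
      (rule rel, assumption, use U1(3) in blast, rule rel, assumption, use U2(3) in blast)
  moreover have "frechet_derivative f (at x) = di q"
    by (simp add: f_def x_def map_diff_eq chart_diff_def c_def c'_def)
  ultimately show ?thesis
    unfolding lie_bracket_def Let_def c_def[symmetric] c'_def[symmetric] fxc by (simp add: x_def)
qed

text \<open>Justifies the definite description. The two extensions are exchanged one at a time: the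
  first by linearity over functions, the second by the Leibniz formula in the frame.\<close>

lemma ambient_deriv_eq:
  assumes D: "affine_connection A D"
    and X: "extends_near A' A i q X V" and Y: "extends_near A' A i q Y W"
  shows "ambient_deriv A' A i D X Y q = D V W (i q)"
  unfolding ambient_deriv_def
proof (rule the_equality)
  show "\<exists>V' W'. extends_near A' A i q X V' \<and> extends_near A' A i q Y W' \<and> D V W (i q) = D V' W' (i q)"
    using X Y by blast
next
  fix w assume "\<exists>V' W'. extends_near A' A i q X V' \<and> extends_near A' A i q Y W' \<and> w = D V' W' (i q)"
  then obtain V' W' where X': "extends_near A' A i q X V'" and Y': "extends_near A' A i q Y W'"
    and w: "w = D V' W' (i q)" by blast
  note [simp] = extends_nearD[OF X] extends_nearD[OF Y] extends_nearD[OF X'] extends_nearD[OF Y']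
  obtain U1 U2 where U1: "open U1" "q \<in> U1" "\<And>r. r \<in> U1 \<Longrightarrow> W (i r) = di r (Y r)"
    and U2: "open U2" "q \<in> U2" "\<And>r. r \<in> U2 \<Longrightarrow> W' (i r) = di r (Y r)"
    using Y Y' unfolding extends_near_def by blast
  show "w = D V W (i q)"
  proof (rule M.connection_in_frame[OF D, of "i q"])
    fix coef E
    assume coef: "\<And>W b. W \<in> vector_fields A \<Longrightarrow> smooth_fun A (coef W b)"
        "\<And>W W' (b :: 'e) r. W r = W' r \<Longrightarrow> coef W b r = coef W' b r"
      and left: "\<And>V W. V \<in> vector_fields A \<Longrightarrow> W \<in> vector_fields A \<Longrightarrow>
        D V W (i q) = (\<Sum>b\<in>Basis. coef V b (i q) *\<^sub>R D (E b) W (i q))"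
      and right: "\<And>V W. V \<in> vector_fields A \<Longrightarrow> W \<in> vector_fields A \<Longrightarrow>
        D V W (i q) = (\<Sum>b\<in>Basis. dir_deriv A (i q) (V (i q)) (coef W b) *\<^sub>R E b (i q)
          + coef W b (i q) *\<^sub>R D V (E b) (i q))"
    have "D V' W' (i q) = D V W' (i q)"
      using left coef(2)[of V' "i q" V] by simp
    also have "\<dots> = D V W (i q)"
    proof -
      \<comment> \<open>The direction is tangent, so the derivative can be taken on the
        hypersurface, where the coefficients of \<open>W\<close> and \<open>W'\<close> agree near
        \<open>q\<close>. In transversal directions they may differ.\<close>
      have "dir_deriv A (i q) (di q (X q)) (coef W' b) = dir_deriv A (i q) (di q (X q)) (coef W b)" for b
        unfolding dir_deriv_di_smooth[OF coef(1)[OF extends_nearD(1)[OF Y']]] dir_deriv_di_smooth[OF coef(1)[OF extends_nearD(1)[OF Y]]]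
      proof (rule N.dir_deriv_cong[of "U1 \<inter> U2"])
        show "(coef W' b \<circ> i) r = (coef W b \<circ> i) r" if "r \<in> U1 \<inter> U2" for r
          using that U1(3) U2(3) by (simp add: coef(2)[of W' "i r" W])
        show "(coef W' b \<circ> i \<circ> chart_inv (chart_at A' q)) differentiable at (snd (chart_at A' q) q)"
          using coef(1)[OF extends_nearD(1)[OF Y'], of b] M.chart_at[of "i q"]
          by (intro differentiable_comp_i smooth_on_differentiable) (auto simp: smooth_fun_def)
      qed (use U1 U2 in auto)
      then show ?thesis using right coef(2)[of W' "i q" W] by simp
    qed
    finally show "w = D V W (i q)" by (simp add: w)
  qed
qed

end

section \<open>The screen distribution\<close>

text \<open>Riesz representation for a possibly indefinite form. \<open>F\<close> stores the numbers
  \<open>b s e\<close> as coordinates in a basis of \<open>S\<close>. Non-degeneracy makes it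
  injective on \<open>S\<close>, equality of dimensions makes it onto \<open>S\<close>, and a
  preimage of the vector with coordinates \<open>L e\<close> represents \<open>L\<close>.\<close>

lemma bilinear_representation:
  fixes b :: "'h::euclidean_space \<Rightarrow> 'h \<Rightarrow> real"
  assumes b: "bilinear b" and S: "subspace S" and nondeg: "\<And>s. s \<in> S \<Longrightarrow> (\<And>t. t \<in> S \<Longrightarrow> b s t = 0) \<Longrightarrow> s = 0"
    and L: "linear L"
  obtains s where "s \<in> S" "\<And>t. t \<in> S \<Longrightarrow> b s t = L t"
proof -
  obtain B where B: "finite B" "B \<subseteq> S" "independent B" "span B = S" "card B = dim S"
    using basis_subspace_exists[OF S] by metis
  have lin1: "linear (\<lambda>s. b s e)" and lin2: "linear (b s)" for s e
    using b by (simp_all add: bilinear_def)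
  define F where "F s = (\<Sum>e\<in>B. b s e *\<^sub>R e)" for s
  have F: "linear F"
    unfolding F_def by (intro linear_compose_sum ballI linear_scaleR_left linear_compose[OF lin1, unfolded comp_def])
  have eq0: "\<forall>e\<in>B. u e = 0" if "(\<Sum>e\<in>B. u e *\<^sub>R e) = 0" for u :: "'h \<Rightarrow> real"
    using independentD[OF B(3,1) subset_refl that] by blast
  have F0: "s = 0" if "s \<in> S" "F s = 0" for s
  proof (rule nondeg[OF that(1)])
    fix t assume "t \<in> S"
    then show "b s t = 0"
      using eq0[of "b s"] that(2) linear_eq_0_on_span[OF lin2, of B s t] B(4) by (auto simp: F_def)
  qed
  have "inj_on F S"
    by (rule inj_onI) (metis F F0 S linear_diff right_minus_eq subspace_diff)
  then have "dim (F ` S) = dim S"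
    using S by (intro dim_image_eq[OF F]) (simp add: span_eq_iff[THEN iffD2])
  moreover have FS: "F ` S \<subseteq> S"
    using B(2) S by (auto simp: F_def intro!: subspace_sum subspace_mul)
  ultimately have FS: "F ` S = S"
    by (intro subspace_dim_equal linear_subspace_image F S) simp_all
  have "(\<Sum>e\<in>B. L e *\<^sub>R e) \<in> S"
    using B(2) S by (auto intro!: subspace_sum subspace_mul)
  then obtain s where s: "s \<in> S" "F s = (\<Sum>e\<in>B. L e *\<^sub>R e)" using FS by (metis imageE)
  have "(\<Sum>e\<in>B. (b s e - L e) *\<^sub>R e) = 0"
    using s(2) by (simp add: F_def scaleR_diff_left sum_subtractf)
  from eq0[OF this] have "\<And>e. e \<in> B \<Longrightarrow> b s e = L e" by simp
  then have "b s t = L t" if "t \<in> S" for t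
    using linear_eq_on_span[OF lin2 L] that B(4) by blast
  with s(1) show thesis by (rule that)
qed

lemma subspace_smooth_distribution: "smooth_distribution A S \<Longrightarrow> subspace (S q)"
  unfolding smooth_distribution_def by (metis subspace_span)

context immersion
begin

lemma bilinear_induced_metric:
  "bilinear (g (i q)) \<Longrightarrow> bilinear (induced_metric A' A i g q)"
  using linear_compose[OF linear_di] unfolding bilinear_def induced_metric_def comp_def by blast

text \<open>Every vector is a screen vector plus a radical one, and the radical part pairs to 0 with
  everything. So a screen vector orthogonal to the screen is itself radical, and the two subspaces
  meet only in 0.\<close>

lemma screen_nondegenerate:
  assumes b: "bilinear (g (i q))" and sym: "\<And>u v. g (i q) u v = g (i q) v u"
    and S: "screen_distribution A' (induced_metric A' A i g) S"
    and s: "s \<in> S q" "\<And>t. t \<in> S q \<Longrightarrow> induced_metric A' A i g q s t = 0"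
  shows "s = 0"
proof -
  let ?b = "induced_metric A' A i g q"
  have "?b s x = 0" for x
  proof -
    have "x \<in> {s + z | s z. s \<in> S q \<and> z \<in> radical (?b)}"
      using S by (simp add: screen_distribution_def)
    then obtain t z where x: "x = t + z" "t \<in> S q" "z \<in> radical ?b" by blast
    have "?b s z = ?b z s" unfolding induced_metric_def by (rule sym)
    then show ?thesis
      using s(2)[OF x(2)] x(3) bilinear_radd[OF bilinear_induced_metric[where g = g, OF b], of s t z]
      by (simp add: x(1) radical_def)
  qed
  then have "s \<in> S q \<inter> radical ?b" using s(1) by (simp add: radical_def)
  then show ?thesis using S by (auto simp: screen_distribution_def)
qed

lemma screen_part:
  assumes b: "bilinear (g (i q))" and sym: "\<And>u v. g (i q) u v = g (i q) v u"
    and S: "screen_distribution A' (induced_metric A' A i g) S"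
  shows "screen_part A' A i g S q w \<in> S q"
    and "t \<in> S q \<Longrightarrow> induced_metric A' A i g q (screen_part A' A i g S q w) t = g (i q) w (di q t)"
proof -
  let ?b = "induced_metric A' A i g q"
  have sub: "subspace (S q)" using S by (auto simp: screen_distribution_def intro: subspace_smooth_distribution)
  note nondeg = screen_nondegenerate[where g = g, OF b sym S]
  note b' = bilinear_induced_metric[where g = g, OF b]
  have L: "linear (\<lambda>t. g (i q) w (di q t))"
    using linear_compose[OF linear_di, of "g (i q) w"] b by (simp add: bilinear_def comp_def)
  obtain s where s: "s \<in> S q" "\<And>t. t \<in> S q \<Longrightarrow> ?b s t = g (i q) w (di q t)"
    using bilinear_representation[OF b' sub nondeg L] by blast
  \<comment> \<open>The only possible \<open>h\<close> is \<open>w - di q s'\<close>, so the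
    description says that \<open>s'\<close> represents the functional sending \<open>t\<close> to
    \<open>g (i q) w (di q t)\<close> on \<open>S q\<close>. Existence is then Riesz representation,
    uniqueness is non-degeneracy.\<close>
  have split: "(\<exists>h. w = di q s' + h \<and> (\<forall>t\<in>S q. g (i q) h (di q t) = 0)) \<longleftrightarrow>
      (\<forall>t\<in>S q. ?b s' t = g (i q) w (di q t))" for s'
  proof -
    have "(\<exists>h. w = di q s' + h \<and> (\<forall>t\<in>S q. g (i q) h (di q t) = 0)) \<longleftrightarrow>
      (\<forall>t\<in>S q. g (i q) (w - di q s') (di q t) = 0)" by (auto intro!: exI[of _ "w - di q s'"])
    also have "\<dots> \<longleftrightarrow> (\<forall>t\<in>S q. ?b s' t = g (i q) w (di q t))"
      by (auto simp: bilinear_lsub[OF b] induced_metric_def)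
    finally show ?thesis .
  qed
  have "screen_part A' A i g S q w = s"
    unfolding screen_part_def split
  proof (rule the_equality)
    fix s' assume s': "s' \<in> S q \<and> (\<forall>t\<in>S q. ?b s' t = g (i q) w (di q t))"
    then have "s' - s \<in> S q" using sub s(1) by (simp add: subspace_diff)
    then have "s' - s = 0" by (rule nondeg) (use s' s(2) in \<open>auto simp: bilinear_lsub[OF b']\<close>)
    then show "s' = s" by simp
  qed (use s in auto)
  with s show "screen_part A' A i g S q w \<in> S q"
    and "t \<in> S q \<Longrightarrow> ?b (screen_part A' A i g S q w) t = g (i q) w (di q t)" by auto
qed

lemma dir_deriv_induced_metric:
  assumes g: "bilinear_field A g" and Y: "extends_near A' A i q Y W" and Z: "extends_near A' A i q Z T"
  shows "dir_deriv A' q u (\<lambda>r. induced_metric A' A i g r (Y r) (Z r)) =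
    dir_deriv A (i q) (di q u) (\<lambda>r. g r (W r) (T r))"
proof -
  obtain U1 U2 where U1: "open U1" "q \<in> U1" "\<And>r. r \<in> U1 \<Longrightarrow> W (i r) = di r (Y r)"
    and U2: "open U2" "q \<in> U2" "\<And>r. r \<in> U2 \<Longrightarrow> T (i r) = di r (Z r)"
    using Y Z unfolding extends_near_def by blast
  have d: "((\<lambda>r. g r (W r) (T r)) \<circ> chart_inv (chart_at A (i q))) differentiable
      (at (snd (chart_at A (i q)) (i q)))"
    by (rule smooth_on_differentiable[OF M.smooth_metric_chart[OF g extends_nearD(1)[OF Y]
            extends_nearD(1)[OF Z] M.chart_at(1)]]) (simp add: M.chart_at)
  have "dir_deriv A' q u ((\<lambda>r. g r (W r) (T r)) \<circ> i) =
      dir_deriv A' q u (\<lambda>r. induced_metric A' A i g r (Y r) (Z r))"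
    by (rule N.dir_deriv_cong[of "U1 \<inter> U2", OF _ _ _ differentiable_comp_i[OF d]])
      (use U1 U2 in \<open>auto simp: induced_metric_def\<close>)
  then show ?thesis by (simp add: dir_deriv_di[OF d])
qed

section \<open>The induced semi-Weyl identity\<close>

lemma screen_connection_metric:
  assumes b: "bilinear (g (i q))" and sym: "\<And>u v. g (i q) u v = g (i q) v u"
    and S: "screen_distribution A' (induced_metric A' A i g) S" and D: "affine_connection A D"
    and X: "extends_near A' A i q X V" and Y: "extends_near A' A i q Y W" and t: "t \<in> S q"
  shows "induced_metric A' A i g q (screen_connection A' A i g S D X Y q) t = g (i q) (D V W (i q)) (di q t)"
  unfolding screen_connection_def ambient_deriv_eq[OF D X Y]
  by (rule screen_part(2)[where g = g, OF b sym S t])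

lemma semi_weyl_torsion_screen:
  assumes g: "bilinear_field A g" and sym: "\<And>p u v. g p u v = g p v u"
    and D: "affine_connection A D" and SW: "semi_weyl_torsion A (vector_fields A) g \<eta> D"
    and S: "screen_distribution A' (induced_metric A' A i g) S"
  shows "semi_weyl_torsion A' (sections A' S)
    (induced_metric A' A i g) (induced_form A' A i \<eta>) (screen_connection A' A i g S D)"
  unfolding semi_weyl_torsion_def
proof (intro ballI allI)
  fix X Y Z q assume "X \<in> sections A' S" "Y \<in> sections A' S" "Z \<in> sections A' S"
  then have X: "X \<in> vector_fields A'" "X q \<in> S q" and Y: "Y \<in> vector_fields A'" "Y q \<in> S q"
    and Z: "Z \<in> vector_fields A'" "Z q \<in> S q" by (auto simp: sections_def)
  obtain V W T where V: "extends_near A' A i q X V" and W: "extends_near A' A i q Y W"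
    and T: "extends_near A' A i q Z T"
    using extension_exists X(1) Y(1) Z(1) by meson
  have b: "bilinear (g p)" for p using g by (simp add: bilinear_field_def)
  note b' = bilinear_induced_metric[where g = g, OF b]
  let ?g = "induced_metric A' A i g" and ?D = "screen_connection A' A i g S D"
  have sym': "?g q u v = ?g q v u" for u v by (simp add: induced_metric_def sym[of "i q" "di q u"])
  note DD = screen_connection_metric[where g = g, OF b sym S D]
  \<comment> \<open>Kept general in the first two fields because the identity uses it with
    \<open>X\<close> and \<open>Y\<close> in both orders.\<close>
  have metric: "deriv_metric A' ?D ?g X' Y' Z q = deriv_metric A D g V' W' T (i q)"
    if X': "extends_near A' A i q X' V'" and Y': "extends_near A' A i q Y' W'" "Y' q \<in> S q" for X' Y' V' W'
  proof -
    \<comment> \<open>The projected derivative stands in the second slot, while the projection is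
      controlled in the first; symmetry of the induced and of the ambient metric carries it
      across.\<close>
    have "?g q (Y' q) (?D X' Z q) = g (i q) (W' (i q)) (D V' T (i q))"
      unfolding sym'[of "Y' q"] DD[OF X' T Y'(2)] extends_nearD(2)[OF Y'(1)] by (rule sym)
    then show ?thesis
      by (simp add: deriv_metric_def dir_deriv_induced_metric[OF g Y'(1) T] DD[OF X' Y'(1) Z(2)]
          extends_nearD(2)[OF X'] extends_nearD(2)[OF T])
  qed
  have torsion: "?g q (torsion A' ?D X Y q) (Z q) = g (i q) (torsion A D V W (i q)) (T (i q))"
  proof -
    have "?g q (lie_bracket A' X Y q) (Z q) = g (i q) (lie_bracket A V W (i q)) (T (i q))"
      by (simp add: induced_metric_def lie_bracket_extension[OF X(1) V Y(1) W] extends_nearD(2)[OF T])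
    then show ?thesis
      by (simp add: torsion_def bilinear_lsub[OF b'] bilinear_lsub[OF b] DD[OF V W Z(2)] DD[OF W V Z(2)]
          extends_nearD(2)[OF T])
  qed
  have form: "induced_form A' A i \<eta> q (X q) = \<eta> (i q) (V (i q))" "induced_form A' A i \<eta> q (Y q) = \<eta> (i q) (W (i q))"
    by (simp_all add: induced_form_def extends_nearD(2)[OF V] extends_nearD(2)[OF W])
  have prod: "?g q (Y q) (Z q) = g (i q) (W (i q)) (T (i q))" "?g q (X q) (Z q) = g (i q) (V (i q)) (T (i q))"
    by (simp_all add: induced_metric_def extends_nearD(2)[OF V] extends_nearD(2)[OF W] extends_nearD(2)[OF T])
  show "deriv_metric A' ?D ?g X Y Z q + induced_form A' A i \<eta> q (X q) * ?g q (Y q) (Z q) =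
    deriv_metric A' ?D ?g Y X Z q + induced_form A' A i \<eta> q (Y q) * ?g q (X q) (Z q)
      - ?g q (torsion A' ?D X Y q) (Z q)"
    unfolding metric[OF V W Y(2)] metric[OF W V X(2)] torsion form prod
    using SW extends_nearD(1)[OF V] extends_nearD(1)[OF W] extends_nearD(1)[OF T]
    unfolding semi_weyl_torsion_def by blast
qed

end

theorem proposition5p2:
  fixes n \<nu> :: nat
    and A :: "('a::{t2_space,second_countable_topology}, 'e::euclidean_space) chart set"
    and g :: "'a \<Rightarrow> 'e \<Rightarrow> 'e \<Rightarrow> real"
    and \<eta> :: "'a \<Rightarrow> 'e \<Rightarrow> real"
    and D :: "('a \<Rightarrow> 'e) \<Rightarrow> ('a \<Rightarrow> 'e) \<Rightarrow> ('a \<Rightarrow> 'e)"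
    and A' :: "('b::{t2_space,second_countable_topology}, 'h::euclidean_space) chart set"
    and i :: "'b \<Rightarrow> 'a"
    and S :: "'b \<Rightarrow> 'h set"
  assumes "DIM('e) = n + 2"
    and "SWMT A \<nu> g \<eta> D"
    and "0 < \<nu>" and "\<nu> < n + 2"
    and "lightlike_hypersurface A' A i g"
    and "screen_distribution A' (induced_metric A' A i g) S"
    and "integrable_distribution A' S"
  shows "semi_weyl_torsion A' (sections A' S)
           (induced_metric A' A i g) (induced_form A' A i \<eta>) (screen_connection A' A i g S D)"
proof -
  interpret immersion A A' i
    using assms(2,5)
    by unfold_locales (auto simp: SWMT_def lightlike_hypersurface_def hypersurface_def)
  show ?thesis
    using assms(2,6) by (intro semi_weyl_torsion_screen) (auto simp: SWMT_def pseudo_riemannian_def)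
qed

end
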